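(* Let $G$ be a countable discrete amenable group acting by homeomorphisms on a compact metric space $(X,d)$, let $\mathcal F=(F_n)_{n\in\mathbb N}$ be a (left) Følner sequence in $G$, and let $\mathscr C$ be a characteristic class of measure-preserving $G$-systems. Define $$\mathrm{Gen}_{\mathcal F}(\mathscr C)=\{x\in X : x\in \mathrm{Gen}_{\mathcal F}(\mu)\text{ for some }\mu\in\mathcal M(\mathscr C)\}.$$ Then $\mathrm{Gen}_{\mathcal F}(\mathscr C)$ is closed in $X$ with respect to the Besicovitch pseudometric $D_{B,\mathcal F}$.
   Context: $\mathcal M_G(X)$ is the set of $G$-invariant Borel probability measures on $X$; each $\mu\in\mathcal M_G(X)$ gives a measure-preserving system $(X,G,\mu)$. A (left) Følner sequence is a sequence $\mathcal F=(F_n)_{n\in\mathbb N}$ of non-empty finite subsets of $G$ with $|gF_n\,\Delta\,F_n|/|F_n|\to 0$ for every $g\in G$. A point $x\in X$ is generic for $\mu$ along $\mathcal F$ if $\frac1{|F_n|}\sum_{f\in F_n}\delta_{fx}\to\mu$ in the weak$^*$ topology; $\mathrm{Gen}_{\mathcal F}(\mu)$ denotes the (possibly empty) set of such points. The Besicovitch pseudometric is $D_{B,\mathcal F}(x,z)=\limsup_{N\to\infty}\frac1{|F_N|}\sum_{g\in F_N}d(gx,gz)$ for $x,z\in X$. Measure-preserving systems are measure-preserving actions of the fixed group $G$ on standard Borel probability spaces. $(Y,G,\nu)$ is a factor of $(Z,G,\kappa)$ if there is a measurable map $\pi:Z\to Y$ with $\pi(gz)=g\pi(z)$ for $\kappa$-almost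 every $z$ and every $g\in G$, and $\pi_*\kappa=\nu$. A joining of a family of systems $(X_i,G,\mu_i)_{i\in I}$, $I\subseteq\mathbb N$, is a probability measure on $\prod_{i\in I}X_i$ that is invariant under the product (diagonal) action of $G$ and has marginals $\mu_i$. A characteristic class is a collection $\mathscr C$ of measure-preserving $G$-systems that is closed under taking factors and under countable (finite or infinite) joinings: a factor of a system in $\mathscr C$ is in $\mathscr C$, and if $(X_i,G,\mu_i)\in\mathscr C$ for all $i\in I$ and $\lambda$ is a joining of them, then $(\prod_{i\in I} X_i,G,\lambda)\in\mathscr C$. $\mathcal M(\mathscr C)\subseteq\mathcal M_G(X)$ is the set of $\mu$ with $(X,G,\mu)\in\mathscr C$. *)

theory Defs
  imports "HOL-Algebra.Group_Action" "HOL-Probability.Probability"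
begin

section \<open>Amenable groups and Folner sequences\<close>

definition amenable_group :: "('g, 'b) monoid_scheme \<Rightarrow> bool" where
  "amenable_group G \<longleftrightarrow> group G \<and>
     (\<exists>m :: 'g set \<Rightarrow> real.
        (\<forall>A. A \<subseteq> carrier G \<longrightarrow> 0 \<le> m A) \<and>
        m (carrier G) = 1 \<and>
        (\<forall>A B. A \<subseteq> carrier G \<and> B \<subseteq> carrier G \<and> A \<inter> B = {} \<longrightarrow> m (A \<union> B) = m A + m B) \<and>
        (\<forall>g\<in>carrier G. \<forall>A. A \<subseteq> carrier G \<longrightarrow> m (g <#\<^bsub>G\<^esub> A) = m A))"

definition folner_sequence :: "('g, 'b) monoid_scheme \<Rightarrow> (nat \<Rightarrow> 'g set) \<Rightarrow> bool" where
  "folner_sequence G F \<longleftrightarrow>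
     (\<forall>n. F n \<subseteq> carrier G \<and> finite (F n) \<and> F n \<noteq> {}) \<and>
     (\<forall>g\<in>carrier G.
        (\<lambda>n. real (card (sym_diff (g <#\<^bsub>G\<^esub> F n) (F n))) / real (card (F n))) \<longlonglongrightarrow> 0)"


section \<open>Measure-preserving systems\<close>

text \<open>The sigma-algebra is the Borel algebra of some Polish topology on the underlying set.\<close>

definition standard_borel :: "'a measure \<Rightarrow> bool" where
  "standard_borel M \<longleftrightarrow>
     (\<exists>\<tau>. topspace \<tau> = space M \<and> completely_metrizable_space \<tau> \<and> second_countable \<tau> \<and>
          sets M = sigma_sets (space M) {U. openin \<tau> U})"

definition mp_system ::
  "('g, 'b) monoid_scheme \<Rightarrow> 'a measure \<Rightarrow> ('g \<Rightarrow> 'a \<Rightarrow> 'a) \<Rightarrow> bool" where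
  "mp_system G M T \<longleftrightarrow> standard_borel M \<and> prob_space M \<and> group_action G (space M) T \<and>
     (\<forall>g\<in>carrier G. T g \<in> M \<rightarrow>\<^sub>M M \<and> distr M M (T g) = M)"

definition factor_system ::
  "('g, 'b) monoid_scheme \<Rightarrow> 'a measure \<Rightarrow> ('g \<Rightarrow> 'a \<Rightarrow> 'a) \<Rightarrow> 'c measure \<Rightarrow> ('g \<Rightarrow> 'c \<Rightarrow> 'c) \<Rightarrow> bool"
  where
  "factor_system G M T N S \<longleftrightarrow>
     (\<exists>p \<in> M \<rightarrow>\<^sub>M N. (AE z in M. \<forall>g\<in>carrier G. p (T g z) = S g (p z)) \<and> distr M N p = N)"

definition isomorphic_system ::
  "('g, 'b) monoid_scheme \<Rightarrow> 'a measure \<Rightarrow> ('g \<Rightarrow> 'a \<Rightarrow> 'a) \<Rightarrow> 'c measure \<Rightarrow> ('g \<Rightarrow> 'c \<Rightarrow> 'c) \<Rightarrow> bool"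
  where
  "isomorphic_system G M T N S \<longleftrightarrow>
     (\<exists>p. bij_betw p (space M) (space N) \<and> p \<in> M \<rightarrow>\<^sub>M N \<and> the_inv_into (space M) p \<in> N \<rightarrow>\<^sub>M M \<and>
          distr M N p = N \<and> (\<forall>g\<in>carrier G. \<forall>z\<in>space M. p (T g z) = S g (p z)))"

definition product_action ::
  "nat set \<Rightarrow> (nat \<Rightarrow> 'a measure) \<Rightarrow> (nat \<Rightarrow> 'g \<Rightarrow> 'a \<Rightarrow> 'a) \<Rightarrow> 'g \<Rightarrow> (nat \<Rightarrow> 'a) \<Rightarrow> (nat \<Rightarrow> 'a)"
  where
  "product_action I M T g = (\<lambda>x\<in>(PiE I (\<lambda>i. space (M i))). \<lambda>i\<in>I. T i g (x i))"

definition joining ::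
  "('g, 'b) monoid_scheme \<Rightarrow> nat set \<Rightarrow> (nat \<Rightarrow> 'a measure) \<Rightarrow> (nat \<Rightarrow> 'g \<Rightarrow> 'a \<Rightarrow> 'a) \<Rightarrow>
   (nat \<Rightarrow> 'a) measure \<Rightarrow> bool" where
  "joining G I M T L \<longleftrightarrow> prob_space L \<and> sets L = sets (PiM I M) \<and>
     (\<forall>g\<in>carrier G. distr L L (product_action I M T g) = L) \<and>
     (\<forall>i\<in>I. distr L (M i) (\<lambda>x. x i) = M i)"


section \<open>Characteristic classes\<close>

text \<open>
  A set cannot contain systems on arbitrary types. A class is therefore given by its members
  whose underlying set is a set of reals, carrying any standard Borel structure (not
  necessarily the one inherited from the reals), and a system on another type belongs to the
  class if it is isomorphic to such a member. No system is lost: a standard Borel space has at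
  most continuum many points (see \<open>mp_system_real_copy\<close> below), and closure under factors
  entails closure under isomorphism.
\<close>

type_synonym 'g system_class = "(real measure \<times> ('g \<Rightarrow> real \<Rightarrow> real)) set"

definition in_class ::
  "('g, 'b) monoid_scheme \<Rightarrow> 'g system_class \<Rightarrow> 'a measure \<Rightarrow> ('g \<Rightarrow> 'a \<Rightarrow> 'a) \<Rightarrow> bool" where
  "in_class G \<C> M T \<longleftrightarrow> (\<exists>(N, S)\<in>\<C>. isomorphic_system G M T N S)"

definition characteristic_class :: "('g, 'b) monoid_scheme \<Rightarrow> 'g system_class \<Rightarrow> bool" where
  "characteristic_class G \<C> \<longleftrightarrow>
     (\<forall>(M, T)\<in>\<C>. mp_system G M T) \<and>
     (\<forall>(M, T)\<in>\<C>. \<forall>N S. mp_system G N S \<and> factor_system G M T N S \<longrightarrow> (N, S) \<in> \<C>) \<and>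
     (\<forall>I M T L. (\<forall>i\<in>I. (M i, T i) \<in> \<C>) \<and> joining G I M T L \<longrightarrow>
        in_class G \<C> L (product_action I M T))"


section \<open>Generic points and the Besicovitch pseudometric\<close>

definition invariant_measures ::
  "('g, 'b) monoid_scheme \<Rightarrow> ('g \<Rightarrow> 'x \<Rightarrow> 'x) \<Rightarrow> 'x::topological_space measure set" where
  "invariant_measures G T =
     {\<mu>. prob_space \<mu> \<and> sets \<mu> = sets borel \<and> (\<forall>g\<in>carrier G. distr \<mu> borel (T g) = \<mu>)}"

definition class_measures ::
  "('g, 'b) monoid_scheme \<Rightarrow> ('g \<Rightarrow> 'x \<Rightarrow> 'x) \<Rightarrow> 'g system_class \<Rightarrow> 'x::topological_space measure set"
  where
  "class_measures G T \<C> = {\<mu> \<in> invariant_measures G T. in_class G \<C> \<mu> T}"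

text \<open>The test functions are not required to be bounded: the space is compact in the application.\<close>

definition weak_star_conv ::
  "(nat \<Rightarrow> 'x::topological_space measure) \<Rightarrow> 'x measure \<Rightarrow> bool" where
  "weak_star_conv M \<mu> \<longleftrightarrow>
     (\<forall>\<phi> :: 'x \<Rightarrow> real. continuous_on UNIV \<phi> \<longrightarrow>
        (\<lambda>n. integral\<^sup>L (M n) \<phi>) \<longlonglongrightarrow> integral\<^sup>L \<mu> \<phi>)"

text \<open>The normalised sum of the point masses at \<open>T f x\<close>, \<open>f \<in> A\<close>.\<close>

definition empirical_measure ::
  "('g \<Rightarrow> 'x \<Rightarrow> 'x) \<Rightarrow> 'g set \<Rightarrow> 'x \<Rightarrow> 'x::topological_space measure" where
  "empirical_measure T A x = distr (uniform_count_measure A) borel (\<lambda>f. T f x)"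

definition Gen ::
  "('g \<Rightarrow> 'x \<Rightarrow> 'x) \<Rightarrow> (nat \<Rightarrow> 'g set) \<Rightarrow> 'x::topological_space measure \<Rightarrow> 'x set" where
  "Gen T F \<mu> = {x. weak_star_conv (\<lambda>n. empirical_measure T (F n) x) \<mu>}"

definition Gen_class ::
  "('g, 'b) monoid_scheme \<Rightarrow> ('g \<Rightarrow> 'x \<Rightarrow> 'x) \<Rightarrow> (nat \<Rightarrow> 'g set) \<Rightarrow> 'g system_class \<Rightarrow>
   'x::topological_space set" where
  "Gen_class G T F \<C> = {x. \<exists>\<mu>\<in>class_measures G T \<C>. x \<in> Gen T F \<mu>}"

definition besicovitch ::
  "('g \<Rightarrow> 'x \<Rightarrow> 'x) \<Rightarrow> (nat \<Rightarrow> 'g set) \<Rightarrow> 'x::metric_space \<Rightarrow> 'x \<Rightarrow> ereal" where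
  "besicovitch T F x z =
     limsup (\<lambda>N. ereal ((\<Sum>g\<in>F N. dist (T g x) (T g z)) / real (card (F N))))"

definition pseudometric_topology :: "('x \<Rightarrow> 'x \<Rightarrow> ereal) \<Rightarrow> 'x topology" where
  "pseudometric_topology D =
     topology (\<lambda>U. \<forall>x\<in>U. \<exists>e::real. 0 < e \<and> {z. D x z < ereal e} \<subseteq> U)"

lemma openin_pseudometric_topology:
  "openin (pseudometric_topology D) U \<longleftrightarrow>
     (\<forall>x\<in>U. \<exists>e::real. 0 < e \<and> {z. D x z < ereal e} \<subseteq> U)"
proof -
  have "istopology (\<lambda>U. \<forall>x\<in>U. \<exists>e::real. 0 < e \<and> {z. D x z < ereal e} \<subseteq> U)"
    unfolding istopology_def
  proof (intro conjI allI impI ballI)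
    fix S U x
    assume S: "\<forall>x\<in>S. \<exists>e::real. 0 < e \<and> {z. D x z < ereal e} \<subseteq> S"
      and U: "\<forall>x\<in>U. \<exists>e::real. 0 < e \<and> {z. D x z < ereal e} \<subseteq> U" and x: "x \<in> S \<inter> U"
    from S x obtain a :: real where a: "0 < a" "{z. D x z < ereal a} \<subseteq> S" by auto
    from U x obtain b :: real where b: "0 < b" "{z. D x z < ereal b} \<subseteq> U" by auto
    have "D x z < ereal a \<and> D x z < ereal b" if "D x z < ereal (min a b)" for z
      using less_le_trans[OF that, of "ereal a"] less_le_trans[OF that, of "ereal b"] by simp
    then show "\<exists>e::real. 0 < e \<and> {z. D x z < ereal e} \<subseteq> S \<inter> U"
      using a b by (intro exI[of _ "min a b"]) auto
  next
    fix \<K> x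
    assume K: "\<forall>K\<in>\<K>. \<forall>x\<in>K. \<exists>e::real. 0 < e \<and> {z. D x z < ereal e} \<subseteq> K" and "x \<in> \<Union>\<K>"
    then obtain A where A: "A \<in> \<K>" "x \<in> A" by auto
    obtain e :: real where "0 < e" "{z. D x z < ereal e} \<subseteq> A"
      using bspec[OF bspec[OF K A(1)] A(2)] by auto
    with A(1) show "\<exists>e::real. 0 < e \<and> {z. D x z < ereal e} \<subseteq> \<Union>\<K>"
      by (intro exI[of _ e]) auto
  qed
  then show ?thesis by (simp add: pseudometric_topology_def topology_inverse')
qed


section \<open>Every system has a copy on a set of reals\<close>

lemma standard_borel_inj_real:
  assumes "standard_borel M"
  obtains h :: "'a \<Rightarrow> real" where "inj_on h (space (M :: 'a measure))"
proof -
  obtain \<tau> where ts: "topspace \<tau> = space M" and cm: "completely_metrizable_space \<tau>"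
    and sc: "second_countable \<tau>"
    using assms by (auto simp: standard_borel_def)
  obtain \<B> where cB: "countable \<B>" and
    B: "\<forall>U x. openin \<tau> U \<and> x \<in> U \<longrightarrow> (\<exists>V\<in>\<B>. x \<in> V \<and> V \<subseteq> U)"
    using sc unfolding second_countable_def by (elim exE conjE)
  have haus: "Hausdorff_space \<tau>"
    by (rule metrizable_imp_Hausdorff_space[OF completely_metrizable_imp_metrizable_space[OF cm]])
  define h1 where "h1 x = to_nat_on \<B> ` {V\<in>\<B>. x \<in> V}" for x
  have inj1: "inj_on h1 (space M)"
  proof (rule inj_onI, rule ccontr)
    fix x y assume xy: "x \<in> space M" "y \<in> space M" "h1 x = h1 y" "x \<noteq> y"
    have eq: "{V\<in>\<B>. x \<in> V} = {V\<in>\<B>. y \<in> V}"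
      using xy(3) unfolding h1_def
      by (subst (asm) inj_on_image_eq_iff[OF inj_on_to_nat_on[OF cB]]) simp_all
    have "\<exists>U V. openin \<tau> U \<and> openin \<tau> V \<and> x \<in> U \<and> y \<in> V \<and> disjnt U V"
      using haus xy ts by (simp add: Hausdorff_space_def)
    then obtain U where U: "openin \<tau> U" "x \<in> U" "y \<notin> U" by (auto simp: disjnt_iff)
    obtain V where "V \<in> \<B>" "x \<in> V" "V \<subseteq> U" using B U(1,2) by meson
    then have "V \<in> {V\<in>\<B>. y \<in> V}" unfolding eq[symmetric] by simp
    with \<open>V \<subseteq> U\<close> U(3) show False by auto
  qed
  obtain j :: "nat set \<Rightarrow> real" where j: "bij_betw j UNIV UNIV"
    using nat_sets_eqpoll_reals unfolding eqpoll_def by auto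
  have "inj_on (j \<circ> h1) (space M)"
    using inj1 inj_on_subset[OF bij_betw_imp_inj_on[OF j] subset_UNIV] by (rule comp_inj_on)
  then show thesis by (rule that)
qed

lemma standard_borel_embed_measure:
  assumes sb: "standard_borel M" and inj: "inj_on h (space M)"
  shows "standard_borel (embed_measure M h)"
proof -
  obtain \<tau> where ts: "topspace \<tau> = space M" and cm: "completely_metrizable_space \<tau>"
    and sc: "second_countable \<tau>" and st: "sets M = sigma_sets (space M) {U. openin \<tau> U}"
    using sb by (auto simp: standard_borel_def)
  let ?k = "the_inv_into (space M) h"
  define \<rho> where "\<rho> = pullback_topology (h ` space M) ?k \<tau>"
  have op: "openin \<rho> S \<longleftrightarrow> (\<exists>U. openin \<tau> U \<and> S = ?k -` U \<inter> h ` space M)" for S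
    by (simp add: \<rho>_def openin_pullback_topology)
  have op': "openin \<rho> S \<longleftrightarrow> (\<exists>U. openin \<tau> U \<and> S = h ` U)" for S
    unfolding op using the_inv_into_vimage[OF inj] openin_subset ts by metis
  have tsr: "topspace \<rho> = h ` space M"
    using ts the_inv_into_into[OF inj]
    by (auto simp: \<rho>_def topspace_pullback_topology the_inv_into_f_f[OF inj])
  have "homeomorphic_map \<tau> \<rho> h"
  proof (rule bijective_open_imp_homeomorphic_map)
    show "continuous_map \<tau> \<rho> h"
      unfolding continuous_map_def
    proof (intro conjI allI impI)
      show "h \<in> topspace \<tau> \<rightarrow> topspace \<rho>" by (auto simp: ts tsr)
      fix V assume "openin \<rho> V"
      then obtain U where U: "openin \<tau> U" "V = h ` U" using op' by blast
      then have "{x \<in> topspace \<tau>. h x \<in> V} = U"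
        using openin_subset[OF U(1)] inj ts by (auto simp: inj_on_def)
      then show "openin \<tau> {x \<in> topspace \<tau>. h x \<in> V}" using U by simp
    qed
    show "open_map \<tau> \<rho> h" using op' by (auto simp: open_map_def)
  qed (use ts tsr inj in auto)
  then have hs: "\<tau> homeomorphic_space \<rho>" using homeomorphic_space by blast
  have "sets (embed_measure M h) = sets (vimage_algebra (h ` space M) ?k M)"
    by (rule sets_embed_eq_vimage_algebra[OF inj])
  also have "\<dots> = {?k -` A \<inter> h ` space M | A. A \<in> sets M}"
    by (rule sets_vimage_algebra2) (auto simp: the_inv_into_f_f[OF inj])
  also have "\<dots> = sigma_sets (h ` space M) {?k -` A \<inter> h ` space M | A. A \<in> {U. openin \<tau> U}}"
    unfolding st by (rule sigma_sets_vimage_commute) (auto simp: the_inv_into_f_f[OF inj])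
  also have "{?k -` A \<inter> h ` space M | A. A \<in> {U. openin \<tau> U}} = {U. openin \<rho> U}"
    using op by auto
  finally have "sets (embed_measure M h) = sigma_sets (h ` space M) {U. openin \<rho> U}" .
  then show ?thesis
    unfolding standard_borel_def space_embed_measure
    using tsr cm sc homeomorphic_completely_metrizable_space[OF hs]
      homeomorphic_space_second_countability[OF hs] by blast
qed

theorem mp_system_real_copy:
  fixes M :: "'a measure"
  assumes "mp_system G M T"
  shows "\<exists>(N :: real measure) S. mp_system G N S \<and> isomorphic_system G M T N S"
proof -
  have sb: "standard_borel M" and ps: "prob_space M" and ga: "group_action G (space M) T"
    and mT: "\<And>g. g \<in> carrier G \<Longrightarrow> T g \<in> M \<rightarrow>\<^sub>M M"
    and dT: "\<And>g. g \<in> carrier G \<Longrightarrow> distr M M (T g) = M"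
    using assms by (auto simp: mp_system_def)
  obtain h :: "'a \<Rightarrow> real" where inj: "inj_on h (space M)"
    using standard_borel_inj_real[OF sb] .
  let ?E = "space M"
  define k where "k = the_inv_into ?E h"
  define N where "N = embed_measure M h"
  define S where "S g = (\<lambda>y\<in>h ` ?E. h (T g (k y)))" for g
  have kh: "k (h x) = x" if "x \<in> ?E" for x
    using that by (simp add: k_def the_inv_into_f_f[OF inj])
  have spN: "space N = h ` ?E" by (simp add: N_def space_embed_measure)
  have mh: "h \<in> M \<rightarrow>\<^sub>M N" unfolding N_def by (rule measurable_embed_measure2'[OF inj])
  have mk: "k \<in> N \<rightarrow>\<^sub>M M"
    unfolding N_def k_def by (rule measurable_embed_measure1)
      (auto cong: measurable_cong simp: the_inv_into_f_f[OF inj])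
  have dh: "distr M N h = N"
    unfolding N_def using embed_measure_eq_distr'[OF inj] by simp
  have TE: "T g x \<in> ?E" if "g \<in> carrier G" "x \<in> ?E" for g x
    using mT[OF that(1)] that(2) by (rule measurable_space)
  have Sh: "S g (h x) = h (T g x)" if "x \<in> ?E" for g x
    using that by (simp add: S_def kh)
  have mS: "S g \<in> N \<rightarrow>\<^sub>M N" if g: "g \<in> carrier G" for g
  proof -
    have "(\<lambda>y. h (T g (k y))) \<in> N \<rightarrow>\<^sub>M N"
      using mk mT[OF g] mh by measurable
    then show ?thesis by (rule measurable_cong[THEN iffD1, rotated]) (simp add: S_def spN)
  qed
  have bijS: "S g \<in> Bij (h ` ?E)" if g: "g \<in> carrier G" for g
  proof -
    have b: "bij_betw (T g) ?E ?E"
      using group_action.bij_prop0[OF ga g] by (simp add: Bij_def)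
    have "S g ` h ` ?E = h ` T g ` ?E" by (force simp: image_image Sh)
    moreover have "inj_on (S g) (h ` ?E)"
    proof (rule inj_onI)
      fix u v assume "u \<in> h ` ?E" "v \<in> h ` ?E" "S g u = S g v"
      then obtain x y where xy: "u = h x" "v = h y" "x \<in> ?E" "y \<in> ?E" "h (T g x) = h (T g y)"
        by (auto simp: Sh)
      then have "T g x = T g y" using inj TE[OF g] by (meson inj_onD)
      then show "u = v" using b xy by (metis bij_betw_imp_inj_on inj_onD)
    qed
    ultimately show ?thesis using b by (auto simp: Bij_def bij_betw_def S_def)
  qed
  have gG: "group G" using ga by (simp add: group_action_def group_hom_def)
  have act: "group_action G (h ` ?E) S"
  proof (unfold group_action_def, rule group_hom.intro)
    show "group_hom_axioms G (BijGroup (h ` ?E)) S"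
    proof (rule group_hom_axioms.intro, rule homI)
      fix a b assume ab: "a \<in> carrier G" "b \<in> carrier G"
      have "S (a \<otimes>\<^bsub>G\<^esub> b) = compose (h ` ?E) (S a) (S b)"
      proof
        fix y
        show "S (a \<otimes>\<^bsub>G\<^esub> b) y = compose (h ` ?E) (S a) (S b) y"
        proof (cases "y \<in> h ` ?E")
          case True
          then obtain x where x: "x \<in> ?E" "y = h x" by auto
          then show ?thesis
            using group_action.composition_rule[OF ga x(1) ab] TE ab by (simp add: compose_eq Sh)
        qed (simp add: S_def compose_def)
      qed
      then show "S (a \<otimes>\<^bsub>G\<^esub> b) = S a \<otimes>\<^bsub>BijGroup (h ` ?E)\<^esub> S b"
        using bijS ab by (simp add: BijGroup_def)
    qed (use bijS in \<open>simp add: BijGroup_def\<close>)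
  qed (simp_all add: gG group_BijGroup)
  have dS: "distr N N (S g) = N" if g: "g \<in> carrier G" for g
  proof -
    have "distr N N (S g) = distr (distr M N h) N (S g)" by (simp add: dh)
    also have "\<dots> = distr M N (S g \<circ> h)" by (rule distr_distr[OF mS[OF g] mh])
    also have "\<dots> = distr M N (h \<circ> T g)" by (rule distr_cong) (auto simp: Sh)
    also have "\<dots> = distr (distr M M (T g)) N h" by (rule distr_distr[symmetric, OF mh mT[OF g]])
    also have "\<dots> = N" by (simp add: dT[OF g] dh)
    finally show ?thesis .
  qed
  have "prob_space N" using prob_space.prob_space_distr[OF ps mh] by (simp add: dh)
  then have "mp_system G N S"
    unfolding mp_system_def spN using act mS dS standard_borel_embed_measure[OF sb inj]
    by (simp add: N_def)
  moreover have "isomorphic_system G M T N S"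
    unfolding isomorphic_system_def spN
    using inj mh mk dh by (intro exI[of _ h]) (auto simp: Sh k_def bij_betw_def)
  ultimately show ?thesis by blast
qed

end

theory Submission
  imports Defs
begin

text \<open>
  Let \<open>x\<close> be a Besicovitch limit of points \<open>z i\<close> generic for measures \<open>\<nu> i\<close> of the class, with the
  distance from \<open>x\<close> to \<open>z i\<close> below \<open>(1/2)\<^sup>i\<close>. Along a subsequence of the Folner sequence the point
  \<open>(x, z 0, z 1, \<dots>)\<close> of the countable power of the space generates an invariant measure \<open>L\<close>. Its
  coordinates after the first have joint law a joining of the \<open>\<nu> i\<close>, and the expected distance
  between the first coordinate and that of \<open>z i\<close> is at most \<open>(1/2)\<^sup>i\<close>; by summability the first
  coordinate is almost surely the limit of the others, so its law \<open>\<mu>\<close> is a factor of the joining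
  and lies in the class. Averages of a continuous function along the orbit of \<open>x\<close> are uniformly
  close to those along the orbits of the \<open>z i\<close>, hence converge along the whole Folner sequence,
  and \<open>x\<close> is generic for \<open>\<mu>\<close>.
\<close>

section \<open>Compact metric spaces\<close>

text \<open>At the first index \<open>n\<close> where two sequences differ, the terms differ by
  \<open>(1/3) ^ n\<close>, while all later terms together contribute at most half of that. Base 3
  leaves this gap; in base 2 the tail could compensate exactly.\<close>

lemma inj_ternary_series:
  "inj (\<lambda>s :: nat \<Rightarrow> bool. \<Sum>i. of_bool (s i) * (1/3 :: real) ^ i)" (is "inj ?c")
proof
  fix s t assume eq: "?c s = ?c t"
  have sm: "summable (\<lambda>i. of_bool (u i) * (1/3 :: real) ^ i)" for u
    by (rule summable_comparison_test'[of "\<lambda>i. (1/3) ^ i" 0]) (auto simp: summable_geometric)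
  define e where "e i = (of_bool (s i) - of_bool (t i)) * (1/3 :: real) ^ i" for i
  have e1: "\<bar>e i\<bar> \<le> (1/3) ^ i" for i
    by (auto simp: e_def abs_mult)
  have se: "summable e" and e0: "suminf e = 0"
    using summable_diff[OF sm[of s] sm[of t]] suminf_diff[OF sm[of s] sm[of t]] eq
    by (simp_all add: e_def[abs_def] left_diff_distrib)
  show "s = t"
  proof (rule ccontr)
    assume "s \<noteq> t"
    then have ex: "\<exists>n. s n \<noteq> t n" by auto
    define n where "n = (LEAST n. s n \<noteq> t n)"
    have sn: "s n \<noteq> t n" unfolding n_def by (rule LeastI_ex[OF ex])
    have less: "s i = t i" if "i < n" for i
      using not_less_Least[of i "\<lambda>n. s n \<noteq> t n"] that by (auto simp: n_def)
    have "suminf e = (\<Sum>i. e (i + Suc n)) + sum e {..<Suc n}"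
      by (rule suminf_split_initial_segment[OF se])
    moreover have "sum e {..<n} = 0"
      by (rule sum.neutral) (use less in \<open>auto simp: e_def\<close>)
    ultimately have en: "e n = - (\<Sum>i. e (i + Suc n))" using e0 by simp
    have geo: "(\<lambda>i. (1/3 :: real) ^ (i + Suc n)) sums ((1/3) ^ Suc n * (1 / (1 - 1/3)))"
      using sums_mult[OF geometric_sums[of "1/3 :: real"], of "(1/3) ^ Suc n"]
      by (simp add: power_add mult_ac)
    have "\<bar>\<Sum>i. e (i + Suc n)\<bar> \<le> (\<Sum>i. (1/3) ^ (i + Suc n))"
      using norm_suminf_le[of "\<lambda>i. e (i + Suc n)" "\<lambda>i. (1/3) ^ (i + Suc n)"]
        e1 sums_summable[OF geo] unfolding real_norm_def by blast
    also have "\<dots> = (1/3) ^ n / 2"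
      using sums_unique[OF geo] by simp
    finally have "\<bar>e n\<bar> \<le> (1/3) ^ n / 2" using en by simp
    moreover have "\<bar>e n\<bar> = (1/3) ^ n" using sn by (auto simp: e_def)
    ultimately show False by simp
  qed
qed

text \<open>Each partial sum depends on finitely many coordinates, hence is continuous for the
  product topology, and comparison with the geometric series makes the convergence uniform.\<close>

lemma continuous_on_ternary_series:
  "continuous_on UNIV (\<lambda>s :: nat \<Rightarrow> bool. \<Sum>i. of_bool (s i) * (1/3 :: real) ^ i)"
proof (rule uniform_limit_theorem[OF _ Weierstrass_m_test])
  show "\<forall>\<^sub>F n in sequentially. continuous_on UNIV
      (\<lambda>s :: nat \<Rightarrow> bool. \<Sum>i<n. of_bool (s i) * (1/3 :: real) ^ i)"
  proof (intro always_eventually allI continuous_intros)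
    fix i :: nat
    have "continuous_on UNIV (of_bool :: bool \<Rightarrow> real)"
      by (simp add: continuous_on_open_vimage open_discrete)
    then show "continuous_on UNIV (\<lambda>s :: nat \<Rightarrow> bool. of_bool (s i) :: real)"
      by (rule continuous_on_compose2) auto
  qed
qed (auto simp: summable_geometric)

section \<open>Compactness, dense sequences and coding by reals\<close>

lemma compact_UNIV_fun:
  assumes "compact (UNIV :: 'a::topological_space set)"
  shows "compact (UNIV :: ('i \<Rightarrow> 'a) set)"
proof -
  have "compact_space (euclidean :: 'a topology)" using assms by (simp add: compact_space_def)
  then have "compact_space (euclidean :: ('i \<Rightarrow> 'a) topology)"
    by (simp add: compact_space_product_topology flip: euclidean_product_topology)
  then show ?thesis by (simp add: compact_space_def)
qed

text \<open>Total boundedness gives finite nets of radius \<open>1 / (n + 1)\<close>; their union is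
  countable and dense.\<close>

lemma compact_metric_dense_sequence:
  assumes "compact (UNIV :: 'z::metric_space set)"
  obtains q :: "nat \<Rightarrow> 'z::metric_space" where "\<And>z e. 0 < e \<Longrightarrow> \<exists>n. dist z (q n) < e"
proof -
  have "\<exists>K. finite K \<and> (UNIV :: 'z set) \<subseteq> (\<Union>x\<in>K. ball x (1 / real (Suc n)))" for n
    using assms unfolding compact_eq_totally_bounded by (auto simp del: of_nat_Suc)
  then obtain K where K: "\<And>n. finite (K n)"
    "\<And>n. (UNIV :: 'z set) \<subseteq> (\<Union>x\<in>K n. ball x (1 / real (Suc n)))" by metis
  define D where "D = (\<Union>n. K n)"
  have cD: "countable D" unfolding D_def by (intro countable_UN) (auto intro: countable_finite K)
  have near: "\<exists>x\<in>D. dist z x < e" if "0 < e" for z e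
  proof -
    obtain n where n: "1 / real (Suc n) < e" using nat_approx_posE[OF \<open>0 < e\<close>] .
    have "z \<in> (\<Union>x\<in>K n. ball x (1 / real (Suc n)))" using K(2) by blast
    then obtain x where "x \<in> K n" "dist x z < 1 / real (Suc n)" by auto
    with n show ?thesis by (intro bexI[of _ x]) (auto simp: D_def dist_commute)
  qed
  then have "D \<noteq> {}" using zero_less_one by blast
  show thesis
  proof (rule that[of "from_nat_into D"])
    show "\<exists>n. dist z (from_nat_into D n) < e" if "0 < e" for z e
      using near[OF that, of z] from_nat_into_surj[OF cD] by metis
  qed
qed

text \<open>A point \<open>z\<close> is coded by the signs of the countably many functions
  \<open>dist z (q j) - r\<close> with \<open>r\<close> rational, a zero being allowed either sign. Permitting both codes
  keeps the set of pairs (code, point) closed, hence compact, and a code still determines the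
  point.\<close>

lemma compact_metric_continuous_image_real:
  assumes cpt: "compact (UNIV :: 'z::metric_space set)"
  obtains C :: "real set" and p :: "real \<Rightarrow> 'z::metric_space"
  where "compact C" "continuous_on C p" "p ` C = UNIV"
proof -
  obtain q :: "nat \<Rightarrow> 'z" where q: "\<And>z e. 0 < e \<Longrightarrow> \<exists>n. dist z (q n) < e"
    using compact_metric_dense_sequence[OF cpt] by blast
  \<comment> \<open>\<open>prod_decode\<close> splits the index into the number of a dense point and
    the number of a rational, so that a code is a plain binary sequence.\<close>
  define f where "f i z = dist z (q (fst (prod_decode i)))
      - real_of_rat (from_nat_into UNIV (snd (prod_decode i)))" for i z
  have cf: "continuous_on UNIV (f i)" for i
    unfolding f_def by (intro continuous_intros)
  define R where "R = {(s :: nat \<Rightarrow> bool, z). \<forall>i. if s i then 0 \<le> f i z else f i z \<le> 0}"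
  define c where "c s = (\<Sum>i. of_bool (s i) * (1/3 :: real) ^ i)" for s :: "nat \<Rightarrow> bool"
  have cb: "closed {s :: nat \<Rightarrow> bool. s i = b}" for i b
    using closed_vimage[OF _ continuous_on_product_coordinates, of "{b}" i]
    by (simp add: vimage_def)
  \<comment> \<open>Splitting by the value of one bit turns each condition into a union of two
    closed rectangles.\<close>
  have "R = (\<Inter>i. {s. s i = True} \<times> {z. 0 \<le> f i z} \<union> {s. s i = False} \<times> {z. f i z \<le> 0})"
    by (auto simp: R_def split: if_splits)
  moreover have "closed \<dots>"
    by (intro closed_INT ballI closed_Un closed_Times cb closed_Collect_le cf continuous_intros)
  ultimately have "closed R" by simp
  moreover have "compact (UNIV :: (nat \<Rightarrow> bool) set)"
    by (intro compact_UNIV_fun finite_imp_compact) simp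
  ultimately have "compact R"
    using compact_Int_closed[OF compact_Times[OF _ cpt], of UNIV R] by simp
  have sep: "z = z'" if "(s, z) \<in> R" "(s, z') \<in> R" for s z z'
  proof -
    have le: "dist w (q j) \<le> dist w' (q j)" if "(s, w) \<in> R" "(s, w') \<in> R" for w w' j
    proof (rule ccontr)
      assume "\<not> ?thesis"
      \<comment> \<open>A rational strictly between the two distances gives \<open>w\<close> and
        \<open>w'\<close> strictly opposite signs at one index, and no single bit admits
        both.\<close>
      then obtain r where r: "dist w' (q j) < real_of_rat r" "real_of_rat r < dist w (q j)"
        using of_rat_dense by (auto simp: not_le)
      obtain k where "from_nat_into UNIV k = r"
        using from_nat_into_surj[of "UNIV :: rat set" r] by auto
      with r have "f (prod_encode (j, k)) w' < 0" "0 < f (prod_encode (j, k)) w"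
        by (simp_all add: f_def)
      moreover have "if s (prod_encode (j, k)) then 0 \<le> f (prod_encode (j, k)) v
        else f (prod_encode (j, k)) v \<le> 0" if "(s, v) \<in> R" for v
        using that unfolding R_def by blast
      ultimately show False using that by (smt (verit))
    qed
    show ?thesis
    proof (rule ccontr)
      assume "z \<noteq> z'"
      then obtain j where "dist z (q j) < dist z z' / 2"
        using q[of "dist z z' / 2" z] by auto
      then show False
        using le[OF that(2) that(1), of j] dist_triangle2[of z z' "q j"] by simp
    qed
  qed
  \<comment> \<open>Codes determine points, so \<open>h\<close> is injective on the compact set
    \<open>R\<close> and has a continuous inverse; its second component is the required
    surjection.\<close>
  define h where "h = (\<lambda>x :: (nat \<Rightarrow> bool) \<times> 'z. c (fst x))"
  have ch: "continuous_on R h"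
    unfolding h_def c_def
    by (rule continuous_on_compose2[OF continuous_on_ternary_series]) (auto intro: continuous_intros)
  have inj: "inj_on h R"
  proof (rule inj_onI)
    fix x y assume "x \<in> R" "y \<in> R" "h x = h y"
    moreover from \<open>h x = h y\<close> have "fst x = fst y"
      using injD[OF inj_ternary_series] by (simp add: h_def c_def)
    ultimately show "x = y" using sep[of "fst x" "snd x" "snd y"] by (metis prod.collapse)
  qed
  let ?g = "the_inv_into R h"
  have cg: "continuous_on (h ` R) ?g"
    by (rule continuous_on_inv[OF ch \<open>compact R\<close>]) (simp add: the_inv_into_f_f[OF inj])
  show thesis
  proof
    show "compact (h ` R)" by (rule compact_continuous_image[OF ch \<open>compact R\<close>])
    show "continuous_on (h ` R) (\<lambda>x. snd (?g x))" by (intro continuous_intros cg)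
    have "z \<in> (\<lambda>x. snd (?g x)) ` h ` R" for z
    proof -
      have "(\<lambda>i. 0 \<le> f i z, z) \<in> R" by (auto simp: R_def)
      then show ?thesis
        by (intro image_eqI[OF _ imageI]) (auto simp: the_inv_into_f_f[OF inj])
    qed
    then show "(\<lambda>x. snd (?g x)) ` h ` R = UNIV" by auto
  qed
qed

text \<open>The metric topology itself is Polish: compactness gives completeness, and the balls of
  radius \<open>1 / (m + 1)\<close> about a dense sequence form a countable base.\<close>

lemma standard_borel_compact_metric:
  fixes M :: "'z::metric_space measure"
  assumes cpt: "compact (UNIV :: 'z set)" and M: "sets M = sets borel"
  shows "standard_borel M"
proof -
  obtain q :: "nat \<Rightarrow> 'z" where q: "\<And>z e. 0 < e \<Longrightarrow> \<exists>n. dist z (q n) < e"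
    using compact_metric_dense_sequence[OF cpt] by blast
  have "second_countable (euclidean :: 'z topology)"
    unfolding second_countable_def
  proof (intro exI conjI allI impI ballI)
    show "countable (range (\<lambda>(n, m). ball (q n) (1 / real (Suc m))))" by simp
    fix U and z :: 'z assume U: "openin euclidean U \<and> z \<in> U"
    then obtain e where e: "0 < e" "ball z e \<subseteq> U" by (auto simp: open_contains_ball)
    obtain m where m: "1 / real (Suc m) < e / 2" using nat_approx_posE[of "e / 2"] e by auto
    obtain n where n: "dist z (q n) < 1 / real (Suc m)" using q[of "1 / real (Suc m)" z] by auto
    have "ball (q n) (1 / real (Suc m)) \<subseteq> ball z e"
    proof
      fix y assume "y \<in> ball (q n) (1 / real (Suc m))"
      then show "y \<in> ball z e" using m n dist_triangle[of z y "q n"] by simp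
    qed
    then show "\<exists>V\<in>range (\<lambda>(n, m). ball (q n) (1 / real (Suc m))). z \<in> V \<and> V \<subseteq> U"
      using n e by (intro bexI[of _ "ball (q n) (1 / real (Suc m))"]) (auto simp: dist_commute)
  qed auto
  moreover have "completely_metrizable_space (euclidean :: 'z topology)"
    using Met_TC.completely_metrizable_space_mtopology[where 'a = 'z] compact_imp_complete[OF cpt]
    by simp
  moreover have "space M = UNIV" using sets_eq_imp_space_eq[OF M] by simp
  moreover have "sets M = sigma_sets UNIV {U :: 'z set. open U}"
    unfolding M borel_def by (simp add: sets_measure_of_conv)
  ultimately show ?thesis
    unfolding standard_borel_def by (intro exI[of _ euclidean]) simp
qed

text \<open>Compactness yields a cluster point \<open>l\<close>, and the limits of the distances
  must be the numbers \<open>dist l (q m)\<close>; a \<open>q m\<close> close to \<open>l\<close>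
  then forces convergence. The criterion tests countably many real sequences, which later makes a
  set of convergence measurable.\<close>

lemma compact_convergent_if_dists_convergent:
  fixes f :: "nat \<Rightarrow> 'z::metric_space"
  assumes cpt: "compact (UNIV :: 'z set)"
    and q: "\<And>z e. 0 < e \<Longrightarrow> \<exists>n. dist z (q n) < e"
    and conv: "\<And>m :: nat. convergent (\<lambda>i. dist (f i) (q m))"
  shows "convergent f"
proof -
  obtain l r where r: "strict_mono r" and l: "(f \<circ> r) \<longlonglongrightarrow> l"
    using compact_imp_seq_compact[OF cpt] unfolding seq_compact_def by blast
  have dl: "(\<lambda>i. dist (f i) (q m)) \<longlonglongrightarrow> dist l (q m)" for m
  proof -
    have "(\<lambda>i. dist ((f \<circ> r) i) (q m)) \<longlonglongrightarrow> dist l (q m)"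
      by (intro tendsto_intros l)
    moreover obtain c where c: "(\<lambda>i. dist (f i) (q m)) \<longlonglongrightarrow> c"
      using conv[of m] by (auto simp: convergent_def)
    moreover have "(\<lambda>i. dist ((f \<circ> r) i) (q m)) \<longlonglongrightarrow> c"
      using LIMSEQ_subseq_LIMSEQ[OF c r] by (simp add: o_def)
    ultimately show ?thesis using LIMSEQ_unique by metis
  qed
  have "f \<longlonglongrightarrow> l"
  proof (rule tendstoI)
    fix e :: real assume "0 < e"
    then obtain m where m: "dist l (q m) < e / 2" using q[of "e / 2" l] by auto
    have "\<forall>\<^sub>F i in sequentially. dist (f i) (q m) < e / 2"
      by (rule order_tendstoD(2)[OF dl m])
    then show "\<forall>\<^sub>F i in sequentially. dist (f i) l < e"
      by eventually_elim (use m dist_triangle2 in \<open>smt (verit) field_sum_of_halves\<close>)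
  qed
  then show ?thesis by (auto simp: convergent_def)
qed

section \<open>Weak limits of empirical measures\<close>

text \<open>Lifting the points along a continuous surjection from a compact set of reals reduces weak
  compactness to Helly's selection theorem.\<close>

lemma empirical_measures_convergent_subseq:
  fixes A :: "nat \<Rightarrow> 'i set" and w :: "'i \<Rightarrow> 'z::metric_space"
  assumes cpt: "compact (UNIV :: 'z set)" and A: "\<And>n. finite (A n)" "\<And>n. A n \<noteq> {}"
  obtains r :: "nat \<Rightarrow> nat" and L :: "'z measure"
  where "strict_mono r" "prob_space L" "sets L = sets borel"
    "\<And>\<phi> :: 'z \<Rightarrow> real. continuous_on UNIV \<phi> \<Longrightarrow>
      (\<lambda>n. (\<Sum>a\<in>A (r n). \<phi> (w a)) / real (card (A (r n)))) \<longlonglongrightarrow> integral\<^sup>L L \<phi>"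
proof -
  obtain C p where C: "compact (C :: real set)" "continuous_on C p" "p ` C = (UNIV :: 'z set)"
    using compact_metric_continuous_image_real[OF cpt] .
  have "closed C" using C(1) by (rule compact_imp_closed)
  have "C \<noteq> {}" using C(3) by auto
  have "\<exists>x\<in>C. p x = w a" for a using C(3) by (metis UNIV_I imageE)
  then obtain t where t: "\<And>a. t a \<in> C" "\<And>a. p (t a) = w a" by metis
  define \<mu> where "\<mu> n = distr (uniform_count_measure (A n)) borel t" for n
  have mt: "t \<in> uniform_count_measure (A n) \<rightarrow>\<^sub>M borel" for n
    by (simp add: measurable_cong_sets[OF sets_uniform_count_measure_count_space refl])
  have rd: "real_distribution (\<mu> n)" for n
    unfolding \<mu>_def
    by (intro prob_space.real_distribution_distr prob_space_uniform_count_measure A mt)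
  have int: "integral\<^sup>L (\<mu> n) f = (\<Sum>a\<in>A n. f (t a)) / real (card (A n))"
    if "continuous_on UNIV f" for f :: "real \<Rightarrow> real" and n
    unfolding \<mu>_def
    by (subst integral_distr[OF mt borel_measurable_continuous_onI[OF that]])
      (rule integral_uniform_count_measure[OF A(1)])
  obtain b where b: "\<And>x. x \<in> C \<Longrightarrow> \<bar>x\<bar> \<le> b"
    using compact_imp_bounded[OF C(1)] by (auto simp: bounded_iff)
  have "tight \<mu>"
    unfolding tight_def
  proof (intro conjI allI impI rd)
    fix e :: real assume "0 < e"
    have tb: "\<bar>t a\<bar> \<le> b" for a using b t(1) by blast
    \<comment> \<open>The interval is open on the left and a lift may equal \<open>- b\<close>,
      hence the end \<open>- b - 1\<close>; this also keeps the interval nonempty for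
      \<open>b = 0\<close>.\<close>
    have "measure (\<mu> n) {- b - 1<..b} = 1" for n
    proof -
      have "t a \<in> {- b - 1<..b}" for a using tb[of a] by auto
      then have "t -` {- b - 1<..b} \<inter> A n = A n" by blast
      then show ?thesis
        using prob_space.prob_space[OF prob_space_uniform_count_measure[OF A]]
        by (simp add: \<mu>_def measure_distr[OF mt] space_uniform_count_measure)
    qed
    moreover have "- b - 1 < b" using tb[of undefined] by simp
    ultimately show "\<exists>a b. a < b \<and> (\<forall>n. 1 - e < measure (\<mu> n) {a<..b})"
      using \<open>0 < e\<close> by (intro exI[of _ "- b - 1"] exI[of _ b]) auto
  qed
  then obtain r M where r: "strict_mono (r :: nat \<Rightarrow> nat)" and M: "real_distribution M"
    and conv: "weak_conv_m (\<mu> \<circ> id \<circ> r) M"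
    using tight_imp_convergent_subsubsequence[OF _ strict_mono_id] by blast
  interpret M: real_distribution M by (rule M)
  have lim: "(\<lambda>n. (\<Sum>a\<in>A (r n). f (t a)) / real (card (A (r n)))) \<longlonglongrightarrow> integral\<^sup>L M f"
    if f: "continuous_on UNIV f" "\<And>x. norm (f x) \<le> B" for f :: "real \<Rightarrow> real" and B
  proof -
    have "(\<lambda>n. integral\<^sup>L ((\<mu> \<circ> id \<circ> r) n) f) \<longlonglongrightarrow> integral\<^sup>L M f"
      using f(1) by (intro weak_conv_imp_integral_bdd_continuous_conv[OF _ M conv _ f(2)])
        (auto simp: rd continuous_on_eq_continuous_at)
    then show ?thesis by (simp add: int[OF f(1)])
  qed
  \<comment> \<open>The truncated distance to \<open>C\<close> vanishes at every lift, so its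
    integral against the limit is zero; as \<open>C\<close> is closed, the zeros of this function
    are exactly the points of \<open>C\<close>.\<close>
  have AE_C: "AE x in M. x \<in> C"
  proof -
    define f where "f x = min 1 (infdist x C)" for x :: real
    have f01: "0 \<le> f x" "f x \<le> 1" for x by (auto simp: f_def infdist_nonneg)
    have cf: "continuous_on UNIV f" unfolding f_def by (intro continuous_intros)
    have "f (t a) = 0" for a using t(1) by (simp add: f_def)
    then have "(\<lambda>n. 0) \<longlonglongrightarrow> integral\<^sup>L M f" using lim[OF cf, of 1] f01 by simp
    then have "integral\<^sup>L M f = 0" by (simp add: LIMSEQ_const_iff)
    moreover have "integrable M f"
      using f01 by (intro M.integrable_const_bound[of _ 1] AE_I2)
        (auto simp: borel_measurable_continuous_onI[OF cf])
    ultimately have "AE x in M. f x = 0"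
      using integral_nonneg_eq_0_iff_AE[of M f] f01 by simp
    then show ?thesis
      by eventually_elim
        (simp add: f_def min_def in_closed_iff_infdist_zero[OF \<open>closed C\<close> \<open>C \<noteq> {}\<close>] split: if_splits)
  qed
  \<comment> \<open>\<open>p\<close> is extended by a constant to be Borel on the whole line; the
    complement of \<open>C\<close> is null for \<open>M\<close>.\<close>
  define P where "P x = (if x \<in> C then p x else undefined)" for x
  have mP: "P \<in> borel \<rightarrow>\<^sub>M borel"
    unfolding P_def[abs_def] using \<open>closed C\<close>
    by (intro borel_measurable_continuous_on_if C) auto
  have mP': "P \<in> M \<rightarrow>\<^sub>M borel" using mP by simp
  show thesis
  proof (rule that[OF r, of "distr M borel P"])
    show "prob_space (distr M borel P)" by (rule M.prob_space_distr[OF mP'])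
    fix \<phi> :: "'z \<Rightarrow> real" assume \<phi>: "continuous_on UNIV \<phi>"
    have "bounded (range \<phi>)"
      by (rule compact_imp_bounded[OF compact_continuous_image[OF \<phi> cpt]])
    then obtain B where B: "\<And>z. norm (\<phi> z) \<le> B" by (auto simp: bounded_iff)
    have "0 \<le> B" using B[of undefined] norm_ge_zero order_trans by blast
    have cp: "continuous_on C (\<phi> \<circ> p)"
      by (rule continuous_on_compose[OF C(2) continuous_on_subset[OF \<phi>]]) simp
    \<comment> \<open>Weak convergence on the line tests bounded continuous functions defined
      everywhere, so the lifted function is extended from \<open>C\<close> with the same
      bound.\<close>
    obtain g where g: "continuous_on UNIV g" "\<And>x. x \<in> C \<Longrightarrow> g x = (\<phi> \<circ> p) x"
      "\<And>x. norm (g x) \<le> B"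
      using Tietze[OF cp, of UNIV B] B \<open>closed C\<close> \<open>0 \<le> B\<close> by auto
    have "integral\<^sup>L (distr M borel P) \<phi> = integral\<^sup>L M (\<lambda>x. \<phi> (P x))"
      by (rule integral_distr[OF mP' borel_measurable_continuous_onI[OF \<phi>]])
    also have "\<dots> = integral\<^sup>L M g"
    proof (rule integral_cong_AE)
      show "(\<lambda>x. \<phi> (P x)) \<in> borel_measurable M"
        by (rule measurable_compose[OF mP' borel_measurable_continuous_onI[OF \<phi>]])
      show "g \<in> borel_measurable M" using borel_measurable_continuous_onI[OF g(1)] by simp
      show "AE x in M. \<phi> (P x) = g x"
        using AE_C by eventually_elim (simp add: P_def g(2))
    qed
    finally show "(\<lambda>n. (\<Sum>a\<in>A (r n). \<phi> (w a)) / real (card (A (r n))))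
        \<longlonglongrightarrow> integral\<^sup>L (distr M borel P) \<phi>"
      using lim[OF g(1,3)] by (simp add: g(2)[OF t(1)] t(2))
  qed simp
qed

text \<open>Bounded continuous functions decrease to the indicator of a closed set, so the measures
  agree on closed sets, an intersection-stable generator of the Borel sets.\<close>

lemma borel_prob_measure_eqI:
  fixes M N :: "'z::metric_space measure"
  assumes M: "prob_space M" "sets M = sets borel" and N: "prob_space N" "sets N = sets borel"
    and eq: "\<And>\<phi> :: 'z \<Rightarrow> real. continuous_on UNIV \<phi> \<Longrightarrow> bounded (range \<phi>) \<Longrightarrow>
      integral\<^sup>L M \<phi> = integral\<^sup>L N \<phi>"
  shows "M = N"
proof -
  have closed_eq: "measure M K = measure N K" if K: "closed K" for K
  proof (cases "K = {}")
    case False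
    \<comment> \<open>The empty set is treated apart because \<open>infdist\<close> to it is zero,
      which would make every \<open>f n\<close> constantly 1.\<close>
    define f where "f n z = max 0 (1 - real n * infdist z K)" for n z
    have f01: "0 \<le> f n z" "f n z \<le> 1" for n z by (auto simp: f_def infdist_nonneg)
    have cf: "continuous_on UNIV (f n)" for n
      unfolding f_def by (intro continuous_intros)
    have mf: "f n \<in> borel \<rightarrow>\<^sub>M borel" for n by (rule borel_measurable_continuous_onI[OF cf])
    have ptw: "(\<lambda>n. f n z) \<longlonglongrightarrow> indicat_real K z" for z
    proof (cases "z \<in> K")
      case True
      then show ?thesis by (simp add: f_def)
    next
      case out: False
      then have pos: "0 < infdist z K" by (rule infdist_pos_not_in_closed[OF K False])
      then obtain m where m: "1 < real m * infdist z K"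
        using reals_Archimedean3 by blast
      have "f n z = 0" if "m \<le> n" for n
      proof -
        have "real m * infdist z K \<le> real n * infdist z K"
          using that pos by (intro mult_right_mono) auto
        with m show ?thesis by (simp add: f_def)
      qed
      then have "\<forall>\<^sub>F n in sequentially. f n z = 0" by (auto simp: eventually_sequentially)
      then show ?thesis using out by (simp add: tendsto_eventually)
    qed
    have lim: "(\<lambda>n. integral\<^sup>L Q (f n)) \<longlonglongrightarrow> measure Q K"
      if Q: "prob_space Q" "sets Q = sets borel" for Q
    proof -
      interpret prob_space Q by (rule Q(1))
      have "(\<lambda>n. integral\<^sup>L Q (f n)) \<longlonglongrightarrow> integral\<^sup>L Q (indicat_real K)"
        using mf f01 ptw K
        by (intro integral_dominated_convergence[where w = "\<lambda>_. 1"])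
          (auto simp: measurable_cong_sets[OF Q(2) refl])
      then show ?thesis using K by (simp add: Q(2))
    qed
    have "integral\<^sup>L M (f n) = integral\<^sup>L N (f n)" for n
      using f01 by (intro eq cf) (auto simp: bounded_iff intro!: exI[of _ 1])
    then show ?thesis
      using LIMSEQ_unique[OF lim[OF M] ] lim[OF N] by simp
  qed simp
  interpret M: prob_space M by (rule M(1))
  interpret N: prob_space N by (rule N(1))
  show ?thesis
  proof (rule measure_eqI_generator_eq[where E = "Collect closed" and \<Omega> = UNIV and A = "\<lambda>_. UNIV"])
    show "Int_stable (Collect closed :: 'z set set)" by (auto simp: Int_stable_def)
    show "emeasure M X = emeasure N X" if "X \<in> Collect closed" for X
      using closed_eq that by (simp add: M.emeasure_eq_measure N.emeasure_eq_measure)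
    show "sets M = sigma_sets UNIV (Collect closed)" "sets N = sigma_sets UNIV (Collect closed)"
      unfolding M(2) N(2) borel_eq_closed by simp_all
  qed auto
qed

section \<open>Limits of joinings\<close>

text \<open>The coordinates \<open>i \<ge> 1\<close> carry a joining of members of the class, and the coordinate
  \<open>0\<close>, being almost surely their limit, is a factor of that joining.\<close>

lemma class_measures_ae_limit:
  fixes G :: "('g, 'b) monoid_scheme"
    and T :: "'g \<Rightarrow> 'x::metric_space \<Rightarrow> 'x"
    and L :: "(nat \<Rightarrow> 'x) measure"
  assumes cpt: "compact (UNIV :: 'x set)"
    and act: "group_action G UNIV T"
    and cT: "\<And>g. g \<in> carrier G \<Longrightarrow> continuous_on UNIV (T g)"
    and cc: "characteristic_class G \<C>"
    and L: "prob_space L" "sets L = sets borel"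
    and inv: "\<And>g. g \<in> carrier G \<Longrightarrow> distr L borel (\<lambda>y i. T g (y i)) = L"
    and marg: "\<And>i. distr L borel (\<lambda>y. y (Suc i)) \<in> class_measures G T \<C>"
    and lim: "AE y in L. (\<lambda>i. y (Suc i)) \<longlonglongrightarrow> y 0"
  shows "distr L borel (\<lambda>y. y 0) \<in> class_measures G T \<C>"
proof -
  interpret L: prob_space L by (rule L(1))
  obtain d :: "nat \<Rightarrow> 'x" where d: "\<And>z e. 0 < e \<Longrightarrow> \<exists>n. dist z (d n) < e"
    using compact_metric_dense_sequence[OF cpt] by blast
  define \<mu> where "\<mu> i = distr L borel (\<lambda>y. y (Suc i))" for i
  define \<mu>0 where "\<mu>0 = distr L borel (\<lambda>y. y 0)"
  have mT: "T g \<in> borel \<rightarrow>\<^sub>M borel" if "g \<in> carrier G" for g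
    by (rule borel_measurable_continuous_onI[OF cT[OF that]])
  have mLc: "(\<lambda>y. y i) \<in> L \<rightarrow>\<^sub>M borel" for i
    unfolding measurable_cong_sets[OF L(2) refl] by (rule measurable_product_coordinates)
  have "(\<lambda>y i. T g (y i)) \<in> borel \<rightarrow>\<^sub>M (borel :: (nat \<Rightarrow> 'x) measure)" if g: "g \<in> carrier G" for g
    by (intro borel_measurable_continuous_onI continuous_on_coordinatewise_then_product
        continuous_on_compose2[OF cT[OF g] continuous_on_product_coordinates]) auto
  then have mTL: "(\<lambda>y i. T g (y i)) \<in> L \<rightarrow>\<^sub>M borel" if "g \<in> carrier G" for g
    unfolding measurable_cong_sets[OF L(2) refl] using that .

  \<comment> \<open>The joining carried by the coordinates from 1 on\<close>
  have "\<exists>N S q. (N, S) \<in> \<C> \<and> bij_betw q UNIV (space N) \<and> q \<in> borel \<rightarrow>\<^sub>M N \<and>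
      the_inv_into UNIV q \<in> N \<rightarrow>\<^sub>M borel \<and> distr (\<mu> i) N q = N \<and>
      (\<forall>g\<in>carrier G. \<forall>z. q (T g z) = S g (q z))" for i
  proof -
    have sp: "space (\<mu> i) = UNIV" and st: "sets (\<mu> i) = sets borel" by (simp_all add: \<mu>_def)
    have "in_class G \<C> (\<mu> i) T" using marg[of i] by (simp add: class_measures_def \<mu>_def)
    then obtain N S where "(N, S) \<in> \<C>" "isomorphic_system G (\<mu> i) T N S"
      unfolding in_class_def by blast
    then show ?thesis
      unfolding isomorphic_system_def sp measurable_cong_sets[OF st refl]
        measurable_cong_sets[OF refl st] by blast
  qed
  \<comment> \<open>Members of \<open>\<C>\<close> live on sets of reals, so each coordinate is
    transported by an isomorphism \<open>q i\<close> before a joining can be formed.\<close>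
  then obtain N S q where NS: "\<And>i. (N i, S i) \<in> \<C>"
    and bq: "\<And>i. bij_betw (q i) UNIV (space (N i))"
    and mq: "\<And>i. q i \<in> borel \<rightarrow>\<^sub>M N i"
    and mk: "\<And>i. the_inv_into UNIV (q i) \<in> N i \<rightarrow>\<^sub>M borel"
    and dq: "\<And>i. distr (\<mu> i) (N i) (q i) = N i"
    and eq: "\<And>i g z. g \<in> carrier G \<Longrightarrow> q i (T g z) = S i g (q i z)"
    by metis
  define k where "k i = the_inv_into UNIV (q i)" for i
  have mk: "k i \<in> N i \<rightarrow>\<^sub>M borel" for i using mk by (simp add: k_def)
  have kq [simp]: "k i (q i z) = z" for i z
    using bq[of i] by (simp add: k_def the_inv_into_f_f bij_betw_def)
  have qk: "q i (k i a) = a" if "a \<in> space (N i)" for i a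
    using bq[of i] that by (simp add: k_def f_the_inv_into_f_bij_betw)
  have mS: "S i g \<in> N i \<rightarrow>\<^sub>M N i" if "g \<in> carrier G" for i g
    using cc NS[of i] that by (fastforce simp: characteristic_class_def mp_system_def)
  let ?PM = "PiM UNIV N"
  have mc: "(\<lambda>x. x i) \<in> ?PM \<rightarrow>\<^sub>M N i" for i
    by (rule measurable_component_singleton) simp
  have spP: "x \<in> space ?PM \<longleftrightarrow> (\<forall>i. x i \<in> space (N i))" for x
    by (auto simp: space_PiM PiE_iff)
  \<comment> \<open>The shift drops coordinate 0, so that the factor \<open>i\<close> of the product
    reads coordinate \<open>Suc i\<close>.\<close>
  define Q where "Q y = (\<lambda>i. q i (y (Suc i)))" for y
  have mQ: "Q \<in> L \<rightarrow>\<^sub>M ?PM"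
    unfolding Q_def[abs_def]
  proof (rule measurable_PiM_single')
    show "(\<lambda>y. q i (y (Suc i))) \<in> L \<rightarrow>\<^sub>M N i" for i
      by (rule measurable_compose[OF mLc mq])
    show "(\<lambda>y i. q i (y (Suc i))) \<in> space L \<rightarrow> (\<Pi>\<^sub>E i\<in>UNIV. space (N i))"
      using measurable_space[OF mq] by auto
  qed
  define J where "J = distr L ?PM Q"
  have sJ: "sets J = sets ?PM" "space J = space ?PM" by (simp_all add: J_def)
  interpret J: prob_space J unfolding J_def by (rule L.prob_space_distr[OF mQ])
  define P where "P = product_action UNIV N S"
  have P: "P g x = (\<lambda>i. S i g (x i))" if "x \<in> space ?PM" for g x
    using that by (simp add: P_def product_action_def space_PiM restrict_def)
  have mP: "P g \<in> ?PM \<rightarrow>\<^sub>M ?PM" if g: "g \<in> carrier G" for g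
  proof -
    have "(\<lambda>x i. S i g (x i)) \<in> ?PM \<rightarrow>\<^sub>M ?PM"
    proof (rule measurable_PiM_single')
      show "(\<lambda>x. S i g (x i)) \<in> ?PM \<rightarrow>\<^sub>M N i" for i
        by (rule measurable_compose[OF mc mS[OF g]])
      show "(\<lambda>x i. S i g (x i)) \<in> space ?PM \<rightarrow> (\<Pi>\<^sub>E i\<in>UNIV. space (N i))"
        using measurable_space[OF mS[OF g]] by (auto simp: spP)
    qed
    then show ?thesis by (rule measurable_cong[THEN iffD1, rotated]) (simp add: P)
  qed
  have PQ: "P g (Q y) = Q (\<lambda>i. T g (y i))" if "g \<in> carrier G" "y \<in> space L" for g y
    using measurable_space[OF mQ that(2)] by (simp add: P Q_def eq[OF that(1)])
  have "joining G UNIV N S J"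
    unfolding joining_def P_def[symmetric]
  proof (intro conjI ballI)
    fix g assume g: "g \<in> carrier G"
    have "distr J J (P g) = distr J ?PM (P g)" by (rule distr_cong) (simp_all add: sJ)
    also have "\<dots> = distr L ?PM (P g \<circ> Q)" unfolding J_def by (rule distr_distr[OF mP[OF g] mQ])
    also have "\<dots> = distr L ?PM (Q \<circ> (\<lambda>y i. T g (y i)))"
      by (rule distr_cong) (simp_all add: PQ[OF g])
    also have "\<dots> = distr (distr L borel (\<lambda>y i. T g (y i))) ?PM Q"
      using mQ unfolding measurable_cong_sets[OF L(2) refl]
      by (intro distr_distr[symmetric] mTL[OF g])
    also have "\<dots> = J" by (simp add: inv[OF g] J_def)
    finally show "distr J J (P g) = J" .
  next
    fix i
    have "distr J (N i) (\<lambda>x. x i) = distr L (N i) ((\<lambda>x. x i) \<circ> Q)"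
      unfolding J_def by (rule distr_distr[OF mc mQ])
    also have "\<dots> = distr L (N i) (q i \<circ> (\<lambda>y. y (Suc i)))" by (simp add: o_def Q_def)
    also have "\<dots> = distr (\<mu> i) (N i) (q i)"
      unfolding \<mu>_def by (rule distr_distr[symmetric, OF mq mLc])
    finally show "distr J (N i) (\<lambda>x. x i) = N i" by (simp add: dq)
  qed (simp_all add: sJ J.prob_space_axioms)
  then have "in_class G \<C> J P"
    using cc NS unfolding characteristic_class_def P_def by blast
  \<comment> \<open>The joining belongs to the class up to isomorphism: \<open>v\<close> carries it
    to a genuine member \<open>(N', S')\<close>, and the factor map has to start there.\<close>
  then obtain N' S' v where NS': "(N', S') \<in> \<C>" and bv: "bij_betw v (space J) (space N')"
    and mv: "v \<in> J \<rightarrow>\<^sub>M N'" and mv': "the_inv_into (space J) v \<in> N' \<rightarrow>\<^sub>M J"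
    and dv: "distr J N' v = N'"
    and ev: "\<And>g x. g \<in> carrier G \<Longrightarrow> x \<in> space J \<Longrightarrow> v (P g x) = S' g (v x)"
    unfolding in_class_def isomorphic_system_def by blast
  define v' where "v' = the_inv_into (space J) v"
  have mv': "v' \<in> N' \<rightarrow>\<^sub>M J" using mv' by (simp add: v'_def)
  have v'v: "v' (v u) = u" if "u \<in> space J" for u
    using bv that by (simp add: v'_def the_inv_into_f_f bij_betw_def)

  \<comment> \<open>The limit map on the joining\<close>
  have mkJ: "(\<lambda>u. k i (u i)) \<in> J \<rightarrow>\<^sub>M borel" for i
    unfolding measurable_cong_sets[OF sJ(1) refl]
    by (rule measurable_compose[OF mc mk])
  \<comment> \<open>Convergence is expressed through distances to the dense points, a countable
    family of conditions on real sequences, so that \<open>E\<close> is visibly measurable.\<close>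
  define E where "E = {u \<in> space J. \<forall>m. convergent (\<lambda>i. dist (k i (u i)) (d m))}"
  define K where "K u = (if u \<in> E then lim (\<lambda>i. k i (u i)) else undefined)" for u
  have mE: "E \<in> sets J"
  proof -
    have "(\<lambda>u. dist (k i (u i)) (d m)) \<in> borel_measurable J" for i m
      by (rule measurable_compose[OF mkJ borel_measurable_continuous_onI])
        (intro continuous_intros)
    then show ?thesis unfolding E_def Cauchy_convergent_iff[symmetric]
      by (intro sets.sets_Collect_countable_All sets_Collect_Cauchy)
  qed
  have convE: "(\<lambda>i. k i (u i)) \<longlonglongrightarrow> K u" if "u \<in> E" for u
    using compact_convergent_if_dists_convergent[OF cpt d] that
    by (auto simp: K_def E_def convergent_LIMSEQ_iff[symmetric])
  have KI: "u \<in> E \<and> K u = l" if "u \<in> space J" "(\<lambda>i. k i (u i)) \<longlonglongrightarrow> l" for u l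
  proof -
    have "u \<in> E"
      using that by (auto simp: E_def convergent_def intro!: tendsto_dist exI)
    then show ?thesis using LIMSEQ_unique[OF convE that(2)] by blast
  qed
  have mK: "K \<in> J \<rightarrow>\<^sub>M borel"
  proof (rule borel_measurable_LIMSEQ_metric)
    \<comment> \<open>The approximants take the default value of \<open>K\<close> off
      \<open>E\<close>, so they converge to \<open>K\<close> everywhere.\<close>
    show "(\<lambda>u. if u \<in> E then k i (u i) else undefined) \<in> J \<rightarrow>\<^sub>M borel" for i
      using mE by (intro measurable_If_set mkJ) (auto simp: sets.Int_space_eq2)
    show "(\<lambda>i. if u \<in> E then k i (u i) else undefined) \<longlonglongrightarrow> K u" for u
      using convE[of u] by (auto simp: K_def)
  qed
  \<comment> \<open>Continuity of \<open>T g\<close> lets it pass through the limit, which also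
    shows that \<open>P g\<close> keeps points of \<open>E\<close> in \<open>E\<close>.\<close>
  have KP: "K (P g u) = T g (K u)" if g: "g \<in> carrier G" and u: "u \<in> E" for g u
  proof -
    have uJ: "u \<in> space J" using u by (simp add: E_def)
    then have ui: "u i \<in> space (N i)" for i by (simp add: sJ spP)
    have "k i (P g u i) = T g (k i (u i))" for i
    proof -
      have "P g u i = S i g (q i (k i (u i)))" using uJ by (simp add: P sJ qk[OF ui])
      then show ?thesis by (simp flip: eq[OF g])
    qed
    moreover have "(\<lambda>i. T g (k i (u i))) \<longlonglongrightarrow> T g (K u)"
      by (rule continuous_on_tendsto_compose[OF cT[OF g] convE[OF u]]) auto
    ultimately show ?thesis
      using KI[of "P g u" "T g (K u)"] measurable_space[OF mP[OF g]] uJ by (simp add: sJ)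
  qed
  \<comment> \<open>Here the assumed almost sure convergence enters: the limit map recovers
    coordinate 0 from the others.\<close>
  have KQ: "AE y in L. Q y \<in> E \<and> K (Q y) = y 0"
    using lim
  proof (rule AE_mp, intro AE_I2 impI)
    fix y assume "y \<in> space L" "(\<lambda>i. y (Suc i)) \<longlonglongrightarrow> y 0"
    then show "Q y \<in> E \<and> K (Q y) = y 0"
      using measurable_space[OF mQ] by (intro KI) (simp_all add: sJ Q_def)
  qed
  then have AE_E: "AE u in J. u \<in> E"
    unfolding J_def using mE sets.sets_into_space[OF mE]
    by (subst AE_distr_iff[OF mQ]) (auto simp: sJ Collect_conj_eq Int_absorb1 Int_commute)
  have mQJ: "Q \<in> L \<rightarrow>\<^sub>M J" unfolding measurable_cong_sets[OF refl sJ(1)] by (rule mQ)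
  have dK: "distr J borel K = \<mu>0"
  proof -
    have "distr J borel K = distr (distr L J Q) borel K"
      unfolding J_def by (intro arg_cong[where f = "\<lambda>M. distr M borel K"] distr_cong) simp_all
    also have "\<dots> = distr L borel (K \<circ> Q)" by (rule distr_distr[OF mK mQJ])
    also have "\<dots> = \<mu>0"
      unfolding \<mu>0_def using KQ by (intro distr_cong_AE measurable_comp[OF mQJ mK] mLc) auto
    finally show ?thesis .
  qed

  \<comment> \<open>The law of coordinate 0 as a factor of the joining\<close>
  have p0: "prob_space \<mu>0" unfolding \<mu>0_def by (rule L.prob_space_distr[OF mLc])
  have s0: "sets \<mu>0 = sets borel" "space \<mu>0 = UNIV" by (simp_all add: \<mu>0_def)
  have inv0: "distr \<mu>0 borel (T g) = \<mu>0" if g: "g \<in> carrier G" for g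
  proof -
    have "distr \<mu>0 borel (T g) = distr L borel (T g \<circ> (\<lambda>y. y 0))"
      unfolding \<mu>0_def by (rule distr_distr[OF mT[OF g] mLc])
    also have "\<dots> = distr L borel ((\<lambda>y. y 0) \<circ> (\<lambda>y i. T g (y i)))" by (simp add: o_def)
    also have "\<dots> = distr (distr L borel (\<lambda>y i. T g (y i))) borel (\<lambda>y. y 0)"
      by (rule distr_distr[symmetric, OF measurable_product_coordinates mTL[OF g]])
    finally show ?thesis by (simp add: inv[OF g] \<mu>0_def)
  qed
  have "mp_system G \<mu>0 T"
    unfolding mp_system_def s0(2)
  proof (intro conjI ballI)
    fix g assume g: "g \<in> carrier G"
    show "T g \<in> \<mu>0 \<rightarrow>\<^sub>M \<mu>0" unfolding measurable_cong_sets[OF s0(1) s0(1)] by (rule mT[OF g])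
    have "distr \<mu>0 \<mu>0 (T g) = distr \<mu>0 borel (T g)" by (rule distr_cong) (simp_all add: s0)
    then show "distr \<mu>0 \<mu>0 (T g) = \<mu>0" by (simp add: inv0[OF g])
  qed (use standard_borel_compact_metric[OF cpt s0(1)] p0 act in auto)
  \<comment> \<open>Closure under factors speaks of systems on sets of reals, so it is applied to a
    real copy of the system on \<open>\<mu>0\<close>.\<close>
  then obtain N0 :: "real measure" and R0 where mp0: "mp_system G N0 R0"
    and iso0: "isomorphic_system G \<mu>0 T N0 R0"
    using mp_system_real_copy by blast
  obtain e where me: "e \<in> \<mu>0 \<rightarrow>\<^sub>M N0" and de: "distr \<mu>0 N0 e = N0"
    and ee: "\<And>g z. g \<in> carrier G \<Longrightarrow> e (T g z) = R0 g (e z)"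
    using iso0 unfolding isomorphic_system_def s0(2) by blast
  have me: "e \<in> borel \<rightarrow>\<^sub>M N0" using me unfolding measurable_cong_sets[OF s0(1) refl] .
  \<comment> \<open>The factor map undoes the isomorphism \<open>v\<close>, takes the limit and
    passes to the real copy.\<close>
  have mp: "e \<circ> K \<circ> v' \<in> N' \<rightarrow>\<^sub>M N0"
    by (intro measurable_comp[OF mv'] measurable_comp[OF mK] me)
  have "factor_system G N' S' N0 R0"
    unfolding factor_system_def
  proof (intro bexI[OF _ mp] conjI)
    \<comment> \<open>A single null set, where \<open>v' z\<close> lies outside \<open>E\<close>,
      serves all group elements at once.\<close>
    have "AE z in distr J N' v. v' z \<in> E"
    proof (subst AE_distr_iff[OF mv])
      show "{z \<in> space N'. v' z \<in> E} \<in> sets N'"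
        using measurable_sets[OF mv' mE] by (simp add: vimage_def Int_def conj_commute)
      show "AE u in J. v' (v u) \<in> E"
        using AE_E by (rule AE_mp) (auto simp: v'v intro!: AE_I2)
    qed
    then have "AE z in N'. v' z \<in> E" by (simp only: dv)
    then show "AE z in N'. \<forall>g\<in>carrier G. (e \<circ> K \<circ> v') (S' g z) = R0 g ((e \<circ> K \<circ> v') z)"
    proof (rule AE_mp, intro AE_I2 impI ballI)
      fix z g assume z: "z \<in> space N'" "v' z \<in> E" and g: "g \<in> carrier G"
      define u where "u = v' z"
      have u: "u \<in> space J" "u \<in> E" using z by (simp_all add: u_def E_def)
      have vu: "v u = z" unfolding u_def v'_def using bv z(1) by (rule f_the_inv_into_f_bij_betw)
      have "P g u \<in> space J" using measurable_space[OF mP[OF g]] u(1) by (simp add: sJ)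
      then have "v' (S' g z) = P g u" using v'v ev[OF g u(1)] vu by metis
      then show "(e \<circ> K \<circ> v') (S' g z) = R0 g ((e \<circ> K \<circ> v') z)"
        using KP[OF g u(2)] ee[OF g] by (simp add: u_def)
    qed
    have "distr N' N0 (e \<circ> K \<circ> v') = distr (distr J N' v) N0 (e \<circ> K \<circ> v')" by (simp add: dv)
    also have "\<dots> = distr J N0 (e \<circ> K \<circ> v' \<circ> v)" by (rule distr_distr[OF mp mv])
    also have "\<dots> = distr J N0 (e \<circ> K)" by (rule distr_cong) (simp_all add: v'v)
    also have "\<dots> = distr (distr J borel K) N0 e" by (rule distr_distr[symmetric, OF me mK])
    finally show "distr N' N0 (e \<circ> K \<circ> v') = N0" by (simp add: dK de)
  qed
  then have "(N0, R0) \<in> \<C>"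
    using cc NS' mp0 unfolding characteristic_class_def by blast
  then have "in_class G \<C> \<mu>0 T" using iso0 by (auto simp: in_class_def)
  then show ?thesis
    using p0 s0 inv0 by (simp add: class_measures_def invariant_measures_def \<mu>0_def)
qed

section \<open>Besicovitch limits of generic points\<close>

lemma abs_sum_diff_le_card_sym_diff:
  fixes f :: "'a \<Rightarrow> real"
  assumes fin: "finite A" "finite B" and bd: "\<And>a. a \<in> A \<union> B \<Longrightarrow> \<bar>f a\<bar> \<le> K"
  shows "\<bar>sum f A - sum f B\<bar> \<le> K * real (card (sym_diff A B))"
proof -
  have "sum f A = sum f (A \<inter> B) + sum f (A - B)" "sum f B = sum f (A \<inter> B) + sum f (B - A)"
    using sum.Int_Diff[OF fin(1), of f B] sum.Int_Diff[OF fin(2), of f A] by (simp_all add: Int_commute)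
  moreover have "\<bar>sum f C\<bar> \<le> K * real (card C)" if "C \<subseteq> A \<union> B" for C
    using sum_norm_bound[of C f K] bd that by (auto simp: mult.commute)
  from this[of "A - B"] this[of "B - A"]
  have "\<bar>sum f (A - B)\<bar> \<le> K * real (card (A - B))" "\<bar>sum f (B - A)\<bar> \<le> K * real (card (B - A))"
    by auto
  moreover have "card (sym_diff A B) = card (A - B) + card (B - A)"
    using fin by (intro card_Un_disjoint) auto
  ultimately show ?thesis by (simp add: distrib_left)
qed

text \<open>Left translation is injective, so the translated sum is a sum over the translate of
  \<open>F n\<close>. The two sums differ on the symmetric difference alone, whose relative size
  tends to zero.\<close>

lemma folner_average_translate:
  fixes f :: "'g \<Rightarrow> real"
  assumes G: "group G" and F: "folner_sequence G F" and h: "h \<in> carrier G"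
    and bd: "\<And>a. a \<in> carrier G \<Longrightarrow> \<bar>f a\<bar> \<le> K"
  shows "(\<lambda>n. (\<Sum>a\<in>F n. f (h \<otimes>\<^bsub>G\<^esub> a)) / real (card (F n)) - (\<Sum>a\<in>F n. f a) / real (card (F n)))
    \<longlonglongrightarrow> 0"
proof -
  interpret group G by (rule G)
  have sub: "F n \<subseteq> carrier G" and fin: "finite (F n)" for n
    using F by (simp_all add: folner_sequence_def)
  define D where "D n = real (card (sym_diff (h <#\<^bsub>G\<^esub> F n) (F n))) / real (card (F n))" for n
  have D: "D \<longlonglongrightarrow> 0" using F h by (simp add: folner_sequence_def D_def[abs_def])
  have img: "h <#\<^bsub>G\<^esub> F n = (\<lambda>a. h \<otimes>\<^bsub>G\<^esub> a) ` F n" for n by (auto simp: l_coset_def)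
  have sub': "h <#\<^bsub>G\<^esub> F n \<subseteq> carrier G" for n using sub h by (auto simp: img)
  have le: "\<bar>(\<Sum>a\<in>F n. f (h \<otimes>\<^bsub>G\<^esub> a)) / real (card (F n)) - (\<Sum>a\<in>F n. f a) / real (card (F n))\<bar> \<le> K * D n"
    for n
  proof -
    have "inj_on (\<lambda>a. h \<otimes>\<^bsub>G\<^esub> a) (F n)"
      using sub h by (intro inj_onI) (metis Units_eq Units_l_cancel subsetD)
    then have "(\<Sum>a\<in>F n. f (h \<otimes>\<^bsub>G\<^esub> a)) = sum f (h <#\<^bsub>G\<^esub> F n)"
      by (simp add: img sum.reindex)
    moreover have "\<bar>sum f (h <#\<^bsub>G\<^esub> F n) - sum f (F n)\<bar>
        \<le> K * real (card (sym_diff (h <#\<^bsub>G\<^esub> F n) (F n)))"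
      by (rule abs_sum_diff_le_card_sym_diff)
        (use fin sub[of n] sub'[of n] in \<open>auto simp: img intro!: bd\<close>)
    ultimately show ?thesis
      by (simp add: D_def divide_right_mono flip: diff_divide_distrib)
  qed
  show ?thesis
    by (rule Lim_null_comparison[OF _ tendsto_mult_right_zero[OF D, of K]])
      (unfold real_norm_def, intro always_eventually allI le)
qed

text \<open>The Krylov-Bogolyubov argument: translating the orbit map \<open>w\<close> changes
  averages of a bounded function by a null sequence, so a weak limit gives \<open>\<phi>\<close> and
  its composition with \<open>S h\<close> the same integral.\<close>

lemma folner_orbit_invariant_limit:
  fixes w :: "'g \<Rightarrow> 'z::metric_space" and S :: "'g \<Rightarrow> 'z \<Rightarrow> 'z"
  assumes G: "group G" and F: "folner_sequence G F" and cpt: "compact (UNIV :: 'z set)"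
    and cS: "\<And>h. h \<in> carrier G \<Longrightarrow> continuous_on UNIV (S h)"
    and Sw: "\<And>h a. h \<in> carrier G \<Longrightarrow> a \<in> carrier G \<Longrightarrow> S h (w a) = w (h \<otimes>\<^bsub>G\<^esub> a)"
  obtains r :: "nat \<Rightarrow> nat" and L :: "'z measure"
  where "strict_mono r" "prob_space L" "sets L = sets borel"
    "\<And>\<phi> :: 'z \<Rightarrow> real. continuous_on UNIV \<phi> \<Longrightarrow>
      (\<lambda>n. (\<Sum>a\<in>F (r n). \<phi> (w a)) / real (card (F (r n)))) \<longlonglongrightarrow> integral\<^sup>L L \<phi>"
    "\<And>h. h \<in> carrier G \<Longrightarrow> distr L borel (S h) = L"
proof -
  have sub: "F n \<subseteq> carrier G" and fin: "finite (F n)" "F n \<noteq> {}" for n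
    using F by (simp_all add: folner_sequence_def)
  obtain r :: "nat \<Rightarrow> nat" and L :: "'z measure" where r: "strict_mono r"
    and L: "prob_space L" "sets L = sets borel"
    and lim: "\<And>\<phi> :: 'z \<Rightarrow> real. continuous_on UNIV \<phi> \<Longrightarrow>
      (\<lambda>n. (\<Sum>a\<in>F (r n). \<phi> (w a)) / real (card (F (r n)))) \<longlonglongrightarrow> integral\<^sup>L L \<phi>"
  proof (rule empirical_measures_convergent_subseq[where A = F and w = w, OF cpt fin], goal_cases)
    case (1 r L)
    then show ?case by (intro that[of r L])
  qed
  show thesis
  proof (rule that[OF r L lim])
    fix h assume h: "h \<in> carrier G"
    have mS: "S h \<in> L \<rightarrow>\<^sub>M borel"
      unfolding measurable_cong_sets[OF L(2) refl] by (rule borel_measurable_continuous_onI[OF cS[OF h]])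
    show "distr L borel (S h) = L"
    proof (rule borel_prob_measure_eqI[OF prob_space.prob_space_distr[OF L(1) mS] _ L])
      fix \<phi> :: "'z \<Rightarrow> real" assume \<phi>: "continuous_on UNIV \<phi>" "bounded (range \<phi>)"
      then obtain K where K: "\<And>z. \<bar>\<phi> z\<bar> \<le> K" by (auto simp: bounded_iff)
      have cS\<phi>: "continuous_on UNIV (\<lambda>z. \<phi> (S h z))"
        by (rule continuous_on_compose2[OF \<phi>(1) cS[OF h]]) auto
      have "(\<Sum>a\<in>F n. \<phi> (S h (w a))) = (\<Sum>a\<in>F n. \<phi> (w (h \<otimes>\<^bsub>G\<^esub> a)))" for n
        using sub[of n] by (intro sum.cong) (auto simp: Sw[OF h])
      then have "(\<lambda>n. (\<Sum>a\<in>F (r n). \<phi> (S h (w a))) / real (card (F (r n)))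
          - (\<Sum>a\<in>F (r n). \<phi> (w a)) / real (card (F (r n)))) \<longlonglongrightarrow> 0"
        using LIMSEQ_subseq_LIMSEQ[OF folner_average_translate[OF G F h, of "\<lambda>a. \<phi> (w a)", OF K] r]
        by (simp add: o_def)
      from tendsto_add[OF this lim[OF \<phi>(1)]]
      have "(\<lambda>n. (\<Sum>a\<in>F (r n). \<phi> (S h (w a))) / real (card (F (r n)))) \<longlonglongrightarrow> integral\<^sup>L L \<phi>"
        by simp
      then have "integral\<^sup>L L (\<lambda>z. \<phi> (S h z)) = integral\<^sup>L L \<phi>"
        using LIMSEQ_unique[OF lim[OF cS\<phi>]] by blast
      then show "integral\<^sup>L (distr L borel (S h)) \<phi> = integral\<^sup>L L \<phi>"
        using integral_distr[OF mS borel_measurable_continuous_onI[OF \<phi>(1)]] by simp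
    qed simp
  qed
qed

section \<open>Generic points and averages along close orbits\<close>

lemma Gen_iff:
  fixes T :: "'g \<Rightarrow> 'x::topological_space \<Rightarrow> 'x"
  assumes "\<And>n. finite (F n)"
  shows "x \<in> Gen T F \<mu> \<longleftrightarrow> (\<forall>\<phi> :: 'x \<Rightarrow> real. continuous_on UNIV \<phi> \<longrightarrow>
    (\<lambda>n. (\<Sum>g\<in>F n. \<phi> (T g x)) / real (card (F n))) \<longlonglongrightarrow> integral\<^sup>L \<mu> \<phi>)"
proof -
  have "integral\<^sup>L (empirical_measure T (F n) x) \<phi> = (\<Sum>g\<in>F n. \<phi> (T g x)) / real (card (F n))"
    if "continuous_on UNIV \<phi>" for \<phi> :: "'x \<Rightarrow> real" and n
  proof -
    have "(\<lambda>g. T g x) \<in> uniform_count_measure (F n) \<rightarrow>\<^sub>M borel"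
      by (simp add: measurable_cong_sets[OF sets_uniform_count_measure_count_space refl])
    then show ?thesis
      unfolding empirical_measure_def
      by (subst integral_distr[OF _ borel_measurable_continuous_onI[OF that]])
        (auto intro: integral_uniform_count_measure assms)
  qed
  then show ?thesis by (simp add: Gen_def weak_star_conv_def)
qed

text \<open>Close pairs are handled by uniform continuity; for pairs at distance at least
  \<open>d\<close> the bound \<open>2 * B\<close> is at most \<open>2 * B / d\<close> times the
  distance. Being affine in the distance, the estimate survives averaging.\<close>

lemma compact_continuous_dist_modulus:
  fixes \<phi> :: "'x::metric_space \<Rightarrow> real"
  assumes cpt: "compact (UNIV :: 'x set)" and \<phi>: "continuous_on UNIV \<phi>" and e: "0 < e"
  obtains K where "0 \<le> K" "\<And>a b. \<bar>\<phi> a - \<phi> b\<bar> \<le> e + K * dist a b"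
proof -
  have "bounded (range \<phi>)" by (rule compact_imp_bounded[OF compact_continuous_image[OF \<phi> cpt]])
  then obtain B where B: "\<And>z. \<bar>\<phi> z\<bar> \<le> B" by (auto simp: bounded_iff)
  then have B0: "0 \<le> B" using abs_ge_zero order_trans by blast
  obtain d where d: "0 < d" "\<And>a b. dist a b < d \<Longrightarrow> dist (\<phi> a) (\<phi> b) < e"
    using compact_uniformly_continuous[OF \<phi> cpt] e
    unfolding uniformly_continuous_on_def by (metis UNIV_I)
  show thesis
  proof
    show "0 \<le> 2 * B / d" using B0 d(1) by simp
    fix a b
    show "\<bar>\<phi> a - \<phi> b\<bar> \<le> e + 2 * B / d * dist a b"
    proof (cases "dist a b < d")
      case True
      then have "\<bar>\<phi> a - \<phi> b\<bar> < e" using d(2) by (simp add: dist_real_def)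
      moreover have "0 \<le> 2 * B / d * dist a b" using B0 d(1) by simp
      ultimately show ?thesis by linarith
    next
      case False
      have "\<bar>\<phi> a - \<phi> b\<bar> \<le> 2 * B" using B[of a] B[of b] by linarith
      also have "\<dots> = 2 * B / d * d" using d(1) by simp
      also have "\<dots> \<le> 2 * B / d * dist a b" using False B0 d(1) by (intro mult_left_mono) auto
      finally show ?thesis using e by linarith
    qed
  qed
qed

lemma besicovitch_less_eventually:
  assumes "besicovitch T F x z < ereal e"
  shows "\<forall>\<^sub>F n in sequentially. (\<Sum>g\<in>F n. dist (T g x) (T g z)) / real (card (F n)) < e"
  using Limsup_lessD[OF assms[unfolded besicovitch_def]] by simp

text \<open>Weak compactness gives convergence along a subsequence of the Folner sequence;
  comparison with nearby points whose averages converge gives it along the full sequence.\<close>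

lemma besicovitch_average_convergent:
  fixes T :: "'g \<Rightarrow> 'x::metric_space \<Rightarrow> 'x" and \<phi> :: "'x \<Rightarrow> real"
  assumes cpt: "compact (UNIV :: 'x set)" and \<phi>: "continuous_on UNIV \<phi>"
    and F: "\<And>n. finite (F n)" "\<And>n. F n \<noteq> {}"
    and near: "\<And>e :: real. 0 < e \<Longrightarrow> \<exists>z. besicovitch T F x z < ereal e \<and>
      convergent (\<lambda>n. (\<Sum>g\<in>F n. \<phi> (T g z)) / real (card (F n)))"
  shows "convergent (\<lambda>n. (\<Sum>g\<in>F n. \<phi> (T g x)) / real (card (F n)))"
proof -
  define a where "a z n = (\<Sum>g\<in>F n. \<phi> (T g z)) / real (card (F n))" for z n
  have "Cauchy (a x)"
  proof (rule metric_CauchyI)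
    fix e :: real assume "0 < e"
    \<comment> \<open>Passing from \<open>x\<close> to \<open>z\<close> costs
      \<open>2 * \<epsilon>\<close> at each of two indices, and the Cauchy property at
      \<open>z\<close> costs one more.\<close>
    define \<epsilon> where "\<epsilon> = e / 5"
    have \<epsilon>: "0 < \<epsilon>" using \<open>0 < e\<close> by (simp add: \<epsilon>_def)
    obtain K where K: "0 \<le> K" "\<And>b c. \<bar>\<phi> b - \<phi> c\<bar> \<le> \<epsilon> + K * dist b c"
      using compact_continuous_dist_modulus[OF cpt \<phi> \<epsilon>] by blast
    \<comment> \<open>With this bound \<open>K\<close> times the averaged distance is at most
      \<open>\<epsilon>\<close>; adding 1 covers \<open>K = 0\<close>.\<close>
    obtain z where z: "besicovitch T F x z < ereal (\<epsilon> / (K + 1))" and cz: "convergent (a z)"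
      using near[of "\<epsilon> / (K + 1)"] \<epsilon> K(1) by (auto simp: a_def[abs_def])
    have "\<forall>\<^sub>F n in sequentially. \<bar>a x n - a z n\<bar> \<le> 2 * \<epsilon>"
      using besicovitch_less_eventually[OF z]
    proof eventually_elim
      fix n
      let ?c = "real (card (F n))"
      let ?D = "(\<Sum>g\<in>F n. dist (T g x) (T g z))"
      assume D: "?D / ?c < \<epsilon> / (K + 1)"
      have c: "0 < ?c" using F[of n] by (simp add: card_gt_0_iff)
      have "\<bar>(\<Sum>g\<in>F n. \<phi> (T g x)) - (\<Sum>g\<in>F n. \<phi> (T g z))\<bar>
          \<le> (\<Sum>g\<in>F n. \<bar>\<phi> (T g x) - \<phi> (T g z)\<bar>)"
        by (simp add: sum_abs flip: sum_subtractf)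
      also have "\<dots> \<le> (\<Sum>g\<in>F n. \<epsilon> + K * dist (T g x) (T g z))" by (intro sum_mono K(2))
      also have "\<dots> = ?c * \<epsilon> + K * ?D" by (simp add: sum.distrib sum_distrib_left)
      finally have "\<bar>a x n - a z n\<bar> \<le> (?c * \<epsilon> + K * ?D) / ?c"
        using c by (simp add: a_def divide_right_mono flip: diff_divide_distrib)
      also have "\<dots> = \<epsilon> + K * (?D / ?c)" using c by (simp add: field_simps)
      also have "K * (?D / ?c) \<le> (K + 1) * (\<epsilon> / (K + 1))"
        using D K(1) by (intro mult_mono) (auto intro!: divide_nonneg_nonneg sum_nonneg)
      also have "\<dots> = \<epsilon>" using K(1) by simp
      finally show "\<bar>a x n - a z n\<bar> \<le> 2 * \<epsilon>" by simp
    qed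
    then obtain M where M: "\<And>n. M \<le> n \<Longrightarrow> \<bar>a x n - a z n\<bar> \<le> 2 * \<epsilon>"
      by (auto simp: eventually_sequentially)
    obtain M' where M': "\<And>m n. M' \<le> m \<Longrightarrow> M' \<le> n \<Longrightarrow> dist (a z m) (a z n) < \<epsilon>"
      using metric_CauchyD[OF convergent_Cauchy[OF cz] \<epsilon>] by blast
    have "dist (a x m) (a x n) < e" if "max M M' \<le> m" "max M M' \<le> n" for m n
    proof -
      have "\<bar>a x m - a z m\<bar> \<le> 2 * \<epsilon>" "\<bar>a x n - a z n\<bar> \<le> 2 * \<epsilon>" "\<bar>a z m - a z n\<bar> < \<epsilon>"
        using M M' that by (simp_all add: dist_real_def)
      then have "\<bar>a x m - a x n\<bar> < 5 * \<epsilon>" by linarith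
      then show ?thesis by (simp add: dist_real_def \<epsilon>_def)
    qed
    then show "\<exists>M. \<forall>m\<ge>M. \<forall>n\<ge>M. dist (a x m) (a x n) < e" by blast
  qed
  then show ?thesis by (simp add: Cauchy_convergent_iff a_def[abs_def])
qed

text \<open>The sum of the distances has finite expectation, so it is almost surely finite and its
  terms tend to zero.\<close>

lemma (in prob_space) AE_tendsto_of_summable_expected_dist:
  fixes Y :: "nat \<Rightarrow> 'a \<Rightarrow> 'x::metric_space"
  assumes int: "\<And>i. integrable M (\<lambda>y. dist (Z y) (Y i y))"
    and bd: "\<And>i. expectation (\<lambda>y. dist (Z y) (Y i y)) \<le> c i" and c: "summable c"
  shows "AE y in M. (\<lambda>i. Y i y) \<longlonglongrightarrow> Z y"
proof -
  have m: "(\<lambda>y. dist (Z y) (Y i y)) \<in> borel_measurable M" for i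
    by (rule borel_measurable_integrable[OF int])
  have c0: "0 \<le> c i" for i
    by (rule order_trans[OF Bochner_Integration.integral_nonneg bd]) simp
  have "(\<integral>\<^sup>+y. (\<Sum>i. ennreal (dist (Z y) (Y i y))) \<partial>M) = (\<Sum>i. \<integral>\<^sup>+y. ennreal (dist (Z y) (Y i y)) \<partial>M)"
    by (rule nn_integral_suminf) (use m in measurable)
  also have "\<dots> \<le> (\<Sum>i. ennreal (c i))"
    by (intro suminf_le) (auto simp: nn_integral_eq_integral[OF int] intro!: ennreal_leI bd)
  also have "\<dots> < \<infinity>" using suminf_ennreal2[OF c0 c] by simp
  finally have "AE y in M. (\<Sum>i. ennreal (dist (Z y) (Y i y))) \<noteq> \<infinity>"
    by (intro nn_integral_PInf_AE) (use m in \<open>auto intro!: borel_measurable_suminf_order\<close>)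
  then show ?thesis
  proof eventually_elim
    fix y assume "(\<Sum>i. ennreal (dist (Z y) (Y i y))) \<noteq> \<infinity>"
    then have "summable (\<lambda>i. dist (Z y) (Y i y))"
      by (intro summable_suminf_not_top) auto
    from summable_LIMSEQ_zero[OF this] show "(\<lambda>i. Y i y) \<longlonglongrightarrow> Z y"
      by (simp add: tendsto_dist_iff[of "\<lambda>i. Y i y"] dist_commute)
  qed
qed

section \<open>Limits of points generic for the class\<close>

lemma Gen_class_besicovitch_limit:
  fixes G :: "('g, 'b) monoid_scheme" and T :: "'g \<Rightarrow> 'x::metric_space \<Rightarrow> 'x"
  assumes cpt: "compact (UNIV :: 'x set)" and act: "group_action G UNIV T"
    and cT: "\<And>g. g \<in> carrier G \<Longrightarrow> continuous_on UNIV (T g)"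
    and F: "folner_sequence G F" and cc: "characteristic_class G \<C>"
    and near: "\<And>e :: real. 0 < e \<Longrightarrow> \<exists>z\<in>Gen_class G T F \<C>. besicovitch T F x z < ereal e"
  shows "x \<in> Gen_class G T F \<C>"
proof -
  have G: "group G" using act by (simp add: group_action_def group_hom_def)
  have fin: "finite (F n)" "F n \<noteq> {}" for n using F by (simp_all add: folner_sequence_def)
  have "\<exists>z \<nu>. \<nu> \<in> class_measures G T \<C> \<and> z \<in> Gen T F \<nu> \<and> besicovitch T F x z < ereal ((1/2) ^ i)"
    for i :: nat
    using near[of "(1/2) ^ i"] by (auto simp: Gen_class_def)
  then obtain z \<nu> where \<nu>: "\<And>i. \<nu> i \<in> class_measures G T \<C>"
    and z: "\<And>i. z i \<in> Gen T F (\<nu> i)"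
    and D: "\<And>i :: nat. besicovitch T F x (z i) < ereal ((1/2) ^ i)"
    by metis
  have \<nu>': "prob_space (\<nu> i)" "sets (\<nu> i) = sets borel" for i
    using \<nu>[of i] by (auto simp: class_measures_def invariant_measures_def)
  \<comment> \<open>The point \<open>x\<close> occupies coordinate 0, so every \<open>z i\<close>
    moves to coordinate \<open>Suc i\<close>.\<close>
  define w where "w i = (case i of 0 \<Rightarrow> x | Suc j \<Rightarrow> z j)" for i
  have w [simp]: "w 0 = x" "w (Suc i) = z i" for i by (simp_all add: w_def)
  have cpt': "compact (UNIV :: (nat \<Rightarrow> 'x) set)" by (rule compact_UNIV_fun[OF cpt])
  obtain r :: "nat \<Rightarrow> nat" and L :: "(nat \<Rightarrow> 'x) measure" where r: "strict_mono r"
    and L: "prob_space L" "sets L = sets borel"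
    and lim: "\<And>\<phi> :: (nat \<Rightarrow> 'x) \<Rightarrow> real. continuous_on UNIV \<phi> \<Longrightarrow>
      (\<lambda>n. (\<Sum>a\<in>F (r n). \<phi> (\<lambda>i. T a (w i))) / real (card (F (r n)))) \<longlonglongrightarrow> integral\<^sup>L L \<phi>"
    and inv: "\<And>h. h \<in> carrier G \<Longrightarrow> distr L borel (\<lambda>y i. T h (y i)) = L"
  proof (rule folner_orbit_invariant_limit[OF G F cpt',
        where S = "\<lambda>h y i. T h (y i)" and w = "\<lambda>a i. T a (w i)"], goal_cases)
    case (3 r L)
    then show ?case by (intro that[of r L])
  next
    case (1 h)
    then show ?case
      by (intro continuous_on_coordinatewise_then_product
          continuous_on_compose2[OF cT continuous_on_product_coordinates]) auto
  next
    case (2 h a)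
    then show ?case using group_action.composition_rule[OF act] by simp
  qed
  interpret L: prob_space L by (rule L(1))
  have mL: "f \<in> L \<rightarrow>\<^sub>M borel" if "continuous_on UNIV f" for f :: "(nat \<Rightarrow> 'x) \<Rightarrow> 'c::topological_space"
    unfolding measurable_cong_sets[OF L(2) refl] by (rule borel_measurable_continuous_onI[OF that])
  have lim_coord: "(\<lambda>n. (\<Sum>a\<in>F (r n). \<phi> (T a (w i))) / real (card (F (r n))))
      \<longlonglongrightarrow> integral\<^sup>L (distr L borel (\<lambda>y. y i)) \<phi>"
    if \<phi>: "continuous_on UNIV \<phi>" for \<phi> :: "'x \<Rightarrow> real" and i
  proof -
    have "continuous_on UNIV (\<lambda>y :: nat \<Rightarrow> 'x. \<phi> (y i))"
      by (rule continuous_on_compose2[OF \<phi> continuous_on_product_coordinates]) simp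
    from lim[OF this] show ?thesis
      by (simp add: integral_distr[OF mL[OF continuous_on_product_coordinates]
            borel_measurable_continuous_onI[OF \<phi>]])
  qed
  have marg: "distr L borel (\<lambda>y. y (Suc i)) = \<nu> i" for i
  proof (rule borel_prob_measure_eqI)
    show "prob_space (distr L borel (\<lambda>y. y (Suc i)))"
      by (rule L.prob_space_distr[OF mL[OF continuous_on_product_coordinates]])
    fix \<phi> :: "'x \<Rightarrow> real" assume \<phi>: "continuous_on UNIV \<phi>"
    \<comment> \<open>Genericity of \<open>z i\<close> persists along the subsequence and identifies
      the marginal of the weak limit.\<close>
    have "(\<lambda>n. (\<Sum>a\<in>F (r n). \<phi> (T a (z i))) / real (card (F (r n)))) \<longlonglongrightarrow> integral\<^sup>L (\<nu> i) \<phi>"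
      using LIMSEQ_subseq_LIMSEQ[OF _ r] z[of i] \<phi> unfolding Gen_iff[OF fin(1)] o_def by fast
    then show "integral\<^sup>L (distr L borel (\<lambda>y. y (Suc i))) \<phi> = integral\<^sup>L (\<nu> i) \<phi>"
      using LIMSEQ_unique lim_coord[OF \<phi>, of "Suc i"] by simp
  qed (simp_all add: \<nu>')
  have cd: "continuous_on UNIV (\<lambda>y :: nat \<Rightarrow> 'x. dist (y 0) (y (Suc i)))" for i
    by (intro continuous_intros continuous_on_product_coordinates)
  have ae: "AE y in L. (\<lambda>i. y (Suc i)) \<longlonglongrightarrow> y 0"
  proof (rule L.AE_tendsto_of_summable_expected_dist)
    fix i
    have "bounded (range (\<lambda>y :: nat \<Rightarrow> 'x. dist (y 0) (y (Suc i))))"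
      by (rule compact_imp_bounded[OF compact_continuous_image[OF cd cpt']])
    then obtain B where "\<And>y :: nat \<Rightarrow> 'x. norm (dist (y 0) (y (Suc i))) \<le> B"
      unfolding bounded_iff by blast
    then show "integrable L (\<lambda>y. dist (y 0) (y (Suc i)))"
      by (intro L.integrable_const_bound[of _ B] mL[OF cd]) auto
    \<comment> \<open>The distance of two coordinates is a continuous test function, so the
      Besicovitch bound passes to the expectation under \<open>L\<close>, with a weak
      inequality.\<close>
    have "\<forall>\<^sub>F n in sequentially.
        (\<Sum>a\<in>F (r n). dist (T a x) (T a (z i))) / real (card (F (r n))) < (1/2) ^ i"
      by (rule eventually_subseq[OF r besicovitch_less_eventually[OF D]])
    then show "L.expectation (\<lambda>y. dist (y 0) (y (Suc i))) \<le> (1/2) ^ i"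
      by (intro tendsto_upperbound[OF lim[OF cd]]) (auto elim: eventually_mono)
  qed (simp add: summable_geometric)
  define \<mu> where "\<mu> = distr L borel (\<lambda>y. y 0)"
  have "\<mu> \<in> class_measures G T \<C>"
    unfolding \<mu>_def by (rule class_measures_ae_limit[OF cpt act cT cc L inv _ ae]) (simp_all add: marg \<nu>)
  moreover have "x \<in> Gen T F \<mu>"
    unfolding Gen_iff[OF fin(1)]
  proof (intro allI impI)
    fix \<phi> :: "'x \<Rightarrow> real" assume \<phi>: "continuous_on UNIV \<phi>"
    have "convergent (\<lambda>n. (\<Sum>g\<in>F n. \<phi> (T g x)) / real (card (F n)))"
    proof (rule besicovitch_average_convergent[OF cpt \<phi> fin])
      fix e :: real assume "0 < e"
      then obtain y where "y \<in> Gen_class G T F \<C>" "besicovitch T F x y < ereal e"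
        using near by blast
      then show "\<exists>y. besicovitch T F x y < ereal e \<and>
          convergent (\<lambda>n. (\<Sum>g\<in>F n. \<phi> (T g y)) / real (card (F n)))"
        using \<phi> unfolding Gen_class_def Gen_iff[OF fin(1)] convergent_def by blast
    qed
    then obtain l where l: "(\<lambda>n. (\<Sum>g\<in>F n. \<phi> (T g x)) / real (card (F n))) \<longlonglongrightarrow> l"
      by (auto simp: convergent_def)
    \<comment> \<open>The limit along the full sequence exists already, so the subsequence that
      produced \<open>L\<close> determines its value.\<close>
    have "l = integral\<^sup>L \<mu> \<phi>"
      using LIMSEQ_unique[OF LIMSEQ_subseq_LIMSEQ[OF l r]] lim_coord[OF \<phi>, of 0]
      by (simp add: o_def \<mu>_def)
    then show "(\<lambda>n. (\<Sum>g\<in>F n. \<phi> (T g x)) / real (card (F n))) \<longlonglongrightarrow> integral\<^sup>L \<mu> \<phi>"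
      using l by simp
  qed
  ultimately show ?thesis unfolding Gen_class_def by blast
qed

theorem corollary4p3:
  fixes G :: "('g, 'b) monoid_scheme"
    and T :: "'g \<Rightarrow> 'x::metric_space \<Rightarrow> 'x"
    and F :: "nat \<Rightarrow> 'g set"
    and \<C> :: "'g system_class"
  assumes "countable (carrier G)" and "amenable_group G"
    and "compact (UNIV :: 'x set)"
    and "group_action G UNIV T"
    and "\<And>g. g \<in> carrier G \<Longrightarrow> homeomorphic_map euclidean euclidean (T g)"
    and "folner_sequence G F"
    and "characteristic_class G \<C>"
  shows "closedin (pseudometric_topology (besicovitch T F)) (Gen_class G T F \<C>)"
proof -
  have top: "topspace (pseudometric_topology (besicovitch T F)) = UNIV"
    using openin_subset[of "pseudometric_topology (besicovitch T F)" UNIV] gt_ex[of "0 :: real"]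
    by (auto simp: openin_pseudometric_topology)
  have cT: "continuous_on UNIV (T g)" if "g \<in> carrier G" for g
    using homeomorphic_imp_continuous_map[OF assms(5)[OF that]] by simp
  show ?thesis
    unfolding closedin_def top openin_pseudometric_topology
  proof (intro conjI ballI)
    fix x assume x: "x \<in> UNIV - Gen_class G T F \<C>"
    show "\<exists>e::real. 0 < e \<and> {z. besicovitch T F x z < ereal e} \<subseteq> UNIV - Gen_class G T F \<C>"
    proof (rule ccontr)
      assume "\<not> ?thesis"
      \<comment> \<open>If every ball about \<open>x\<close> meets the set, then \<open>x\<close> is
        a Besicovitch limit of its points and belongs to it.\<close>
      then have "\<exists>z\<in>Gen_class G T F \<C>. besicovitch T F x z < ereal e" if "0 < e" for e :: real
        using that by blast
      then show False
        using Gen_class_besicovitch_limit[OF assms(3,4) cT assms(6,7)] x by blast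
    qed
  qed simp
qed

end
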